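(* If $\lambda X$ is a supersorted PTS, then $\lambda X$ and its corresponding HPTS $\lambda X^h$ have exactly the same theorems, i.e. for all $M,A$: $\vdash M:A$ in $\lambda X$ iff $\vdash M:A$ in $\lambda X^h$.
   Context: A pure type system (PTS) $\lambda X$ with specification $(\mathcal S,\mathcal A,\mathcal R)$ has pseudoterms built from variables, constants $\mathcal C\supseteq\mathcal S$, $\Pi x{:}A.B$, $\lambda x{:}A.B$ and application; axioms $c:s\in\mathcal A$; rules $(s_1,s_2,s_3)\in\mathcal R$; and the usual rules (axiom), (start), (weakening), (application), (abstraction), (product), (conversion). A theorem is a derivable judgement with empty context. $\lambda X$ is supersorted if every constant $c\in\mathcal C$ has some $s\in\mathcal S$ with $(c:s)\in\mathcal A$, and for all $s_1,s_2\in\mathcal S$ there is $s_3\in\mathcal S$ with $(s_1,s_2,s_3)\in\mathcal R$. A Hilbert-style PTS (HPTS) has only empty contexts, the axioms $\mathcal A$, a finite set $\mathcal B$ of axiom schemes (with sort variables ranging over sorts), and the rules (application) and (conversion) with empty contexts, plus (type reduction): from $\vdash M:A$ and $A\to_\beta B$ infer $\vdash M:B$; and (subject reduction): from $\vdash M:A$ and $M\to_\beta N$ infer $\vdash N:A$. The corresponding HPTS $\lambda X^h$ of a supersorted $\lambda X$ has specification $(\mathcal S,\mathcal A,\mathcal B)$, where $\mathcal B$ consists of the following theorems of $\lambda X$ ($s_1,s_2,s_3$ are sort variables): Axiom Π1: $[\lambda u{:}s_1.\lambda v{:}(\Pi x{:}u.s_2).\Pi x{:}u.vx]:[\Pi u{:}s_1.\Pi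 v{:}(\Pi x{:}u.s_2).s_3]$ for $(s_1,s_2,s_3)\in\mathcal R$; Axiom I1: $[\lambda x{:}s_1.\lambda y{:}x.y]:[\Pi x{:}s_1.\Pi y{:}x.x]$; Axiom K1: $[\lambda x{:}s_1.\lambda y{:}s_2.\lambda z{:}x.\lambda u{:}y.z]:[\Pi x{:}s_1.\Pi y{:}s_2.\Pi z{:}x.\Pi u{:}y.x]$; Axiom S1: $[\lambda u{:}s_1.\lambda v{:}(\Pi x{:}u.s_2).\lambda t{:}(\Pi x{:}u.\Pi y{:}vx.s_3).\lambda w{:}(\Pi x{:}u.\Pi y{:}vx.txy).\lambda z{:}(\Pi x{:}u.vx).\lambda x{:}u.wx(zx)]:[\Pi u{:}s_1.\Pi v{:}(\Pi x{:}u.s_2).\Pi t{:}(\Pi x{:}u.\Pi y{:}vx.s_3).\Pi w{:}(\Pi x{:}u.\Pi y{:}vx.txy).\Pi z{:}(\Pi x{:}u.vx).\Pi x{:}u.tx(zx)]$; together with further axioms generated by: (I) if $(M:A)\in\mathcal B$, $A\notin\mathcal S$, and $A'$ is obtained from $A$ by replacing any second occurrence of a sort variable $s_i$ in $A$ by any $s_j$ not in $A$, then if $\vdash A':s$ in $\lambda X$ for $s\in\mathcal S$, $(A':s)\in\mathcal B$ (dropping conditions not needed for $\vdash A':s$); (II) if $([\lambda x_1{:}A_1\ldots\lambda x_{i-1}{:}A_{i-1}.\Pi x_i{:}A_i.B]:[\Pi x_1{:}A_1\ldots\Pi x_{i-1}{:}A_{i-1}.s])\in\mathcal B$ and a sort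 $s'$ satisfies $\vdash(\lambda x_1{:}A_1\ldots\lambda x_i{:}A_i.B):(\Pi x_1{:}A_1\ldots\Pi x_i{:}A_i.s')$ in $\lambda X$, then $([\lambda x_1{:}A_1\ldots\lambda x_i{:}A_i.B]:[\Pi x_1{:}A_1\ldots\Pi x_i{:}A_i.s'])\in\mathcal B$. *)

theory Defs
  imports Main
begin

text \<open>
  Pseudoterms use de Bruijn indices. The type argument is the set of constants.
\<close>

datatype 'c trm =
    Var nat
  | Cst 'c
  | Pi "'c trm" "'c trm"
  | Lam "'c trm" "'c trm"
  | App "'c trm" "'c trm"

primrec lift :: "'c trm \<Rightarrow> nat \<Rightarrow> 'c trm" where
  "lift (Var i) k = (if i < k then Var i else Var (Suc i))"
| "lift (Cst c) k = Cst c"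
| "lift (Pi A B) k = Pi (lift A k) (lift B (Suc k))"
| "lift (Lam A M) k = Lam (lift A k) (lift M (Suc k))"
| "lift (App M N) k = App (lift M k) (lift N k)"

primrec subst :: "'c trm \<Rightarrow> 'c trm \<Rightarrow> nat \<Rightarrow> 'c trm" where
  "subst (Var i) N k = (if k < i then Var (i - 1) else if i = k then N else Var i)"
| "subst (Cst c) N k = Cst c"
| "subst (Pi A B) N k = Pi (subst A N k) (subst B (lift N 0) (Suc k))"
| "subst (Lam A M) N k = Lam (subst A N k) (subst M (lift N 0) (Suc k))"
| "subst (App M P) N k = App (subst M N k) (subst P N k)"

inductive beta :: "'c trm \<Rightarrow> 'c trm \<Rightarrow> bool" where
  beta: "beta (App (Lam A M) N) (subst M N 0)"
| PiL: "beta A A' \<Longrightarrow> beta (Pi A B) (Pi A' B)"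
| PiR: "beta B B' \<Longrightarrow> beta (Pi A B) (Pi A B')"
| LamL: "beta A A' \<Longrightarrow> beta (Lam A M) (Lam A' M)"
| LamR: "beta M M' \<Longrightarrow> beta (Lam A M) (Lam A M')"
| AppL: "beta M M' \<Longrightarrow> beta (App M N) (App M' N)"
| AppR: "beta N N' \<Longrightarrow> beta (App M N) (App M N')"

abbreviation beta_conv :: "'c trm \<Rightarrow> 'c trm \<Rightarrow> bool" where
  "beta_conv \<equiv> equivclp beta"

record 'c pts =
  Sorts :: "'c set"
  Axioms :: "('c \<times> 'c) set"
  Rules :: "('c \<times> 'c \<times> 'c) set"

definition is_pts :: "'c pts \<Rightarrow> bool" where
  "is_pts X \<longleftrightarrow>
     Axioms X \<subseteq> UNIV \<times> Sorts X \<and> Rules X \<subseteq> Sorts X \<times> Sorts X \<times> Sorts X"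

text \<open>
  A context is a list of types with the most recent declaration first; the type in
  position \<open>i\<close> is relative to the declarations after it in the list.
\<close>

inductive pts_typing :: "'c pts \<Rightarrow> 'c trm list \<Rightarrow> 'c trm \<Rightarrow> 'c trm \<Rightarrow> bool" for X where
  ax: "(c, s) \<in> Axioms X \<Longrightarrow> pts_typing X [] (Cst c) (Cst s)"
| start: "\<lbrakk>pts_typing X \<Gamma> A (Cst s); s \<in> Sorts X\<rbrakk>
    \<Longrightarrow> pts_typing X (A # \<Gamma>) (Var 0) (lift A 0)"
| weakening: "\<lbrakk>pts_typing X \<Gamma> M B; pts_typing X \<Gamma> A (Cst s); s \<in> Sorts X\<rbrakk>
    \<Longrightarrow> pts_typing X (A # \<Gamma>) (lift M 0) (lift B 0)"
| application: "\<lbrakk>pts_typing X \<Gamma> M (Pi A B); pts_typing X \<Gamma> N A\<rbrakk>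
    \<Longrightarrow> pts_typing X \<Gamma> (App M N) (subst B N 0)"
| abstraction: "\<lbrakk>pts_typing X (A # \<Gamma>) M B; pts_typing X \<Gamma> (Pi A B) (Cst s); s \<in> Sorts X\<rbrakk>
    \<Longrightarrow> pts_typing X \<Gamma> (Lam A M) (Pi A B)"
| product: "\<lbrakk>pts_typing X \<Gamma> A (Cst s1); pts_typing X (A # \<Gamma>) B (Cst s2);
      (s1, s2, s3) \<in> Rules X\<rbrakk>
    \<Longrightarrow> pts_typing X \<Gamma> (Pi A B) (Cst s3)"
| conversion: "\<lbrakk>pts_typing X \<Gamma> M A; pts_typing X \<Gamma> B (Cst s); s \<in> Sorts X; beta_conv A B\<rbrakk>
    \<Longrightarrow> pts_typing X \<Gamma> M B"

abbreviation pts_theorem :: "'c pts \<Rightarrow> 'c trm \<Rightarrow> 'c trm \<Rightarrow> bool" where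
  "pts_theorem X M A \<equiv> pts_typing X [] M A"

definition supersorted :: "'c pts \<Rightarrow> bool" where
  "supersorted X \<longleftrightarrow>
     (\<forall>c. \<exists>s \<in> Sorts X. (c, s) \<in> Axioms X) \<and>
     (\<forall>s1 \<in> Sorts X. \<forall>s2 \<in> Sorts X. \<exists>s3 \<in> Sorts X. (s1, s2, s3) \<in> Rules X)"

text \<open>
  An axiom scheme \<open>(P, M, A)\<close> is a statement \<open>M : A\<close> over sort variables together with its
  side condition \<open>P\<close>. The sort variable \<open>s\<^sub>i\<close> is \<open>Cst i\<close> in \<^typ>\<open>nat trm\<close>. The instances are
  \<open>map_trm \<rho> M : map_trm \<rho> A\<close> for the assignments \<open>\<rho>\<close> of sorts to the sort variables that
  satisfy \<open>P\<close>.
\<close>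

type_synonym 'c scheme = "((nat \<Rightarrow> 'c) \<Rightarrow> bool) \<times> nat trm \<times> nat trm"

record 'c hpts =
  HSorts :: "'c set"
  HAxioms :: "('c \<times> 'c) set"
  HSchemes :: "'c scheme set"

inductive hpts_theorem :: "'c hpts \<Rightarrow> 'c trm \<Rightarrow> 'c trm \<Rightarrow> bool" for H where
  ax: "(c, s) \<in> HAxioms H \<Longrightarrow> hpts_theorem H (Cst c) (Cst s)"
| scheme: "\<lbrakk>(P, M, A) \<in> HSchemes H; range \<rho> \<subseteq> HSorts H; P \<rho>\<rbrakk>
    \<Longrightarrow> hpts_theorem H (map_trm \<rho> M) (map_trm \<rho> A)"
| application: "\<lbrakk>hpts_theorem H M (Pi A B); hpts_theorem H N A\<rbrakk>
    \<Longrightarrow> hpts_theorem H (App M N) (subst B N 0)"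
| conversion: "\<lbrakk>hpts_theorem H M A; hpts_theorem H B (Cst s); s \<in> HSorts H; beta_conv A B\<rbrakk>
    \<Longrightarrow> hpts_theorem H M B"
| type_reduction: "\<lbrakk>hpts_theorem H M A; beta A B\<rbrakk> \<Longrightarrow> hpts_theorem H M B"
| subject_reduction: "\<lbrakk>hpts_theorem H M A; beta M N\<rbrakk> \<Longrightarrow> hpts_theorem H N A"

abbreviation lams :: "'c trm list \<Rightarrow> 'c trm \<Rightarrow> 'c trm" where
  "lams As M \<equiv> foldr Lam As M"

abbreviation pis :: "'c trm list \<Rightarrow> 'c trm \<Rightarrow> 'c trm" where
  "pis As B \<equiv> foldr Pi As B"

primrec sort_vars :: "nat trm \<Rightarrow> nat list" where
  "sort_vars (Var i) = []"
| "sort_vars (Cst i) = [i]"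
| "sort_vars (Pi A B) = sort_vars A @ sort_vars B"
| "sort_vars (Lam A M) = sort_vars A @ sort_vars M"
| "sort_vars (App M N) = sort_vars M @ sort_vars N"

text \<open>
  \<open>A'\<close> arises from \<open>A\<close> by replacing one second occurrence (from left to right) of a sort
  variable by a sort variable that is not in \<open>A\<close>. The equation between the images under
  \<open>map_trm (\<lambda>_. ())\<close> says that \<open>A\<close> and \<open>A'\<close> agree up to the names of the sort variables.
\<close>

definition replace_second :: "nat trm \<Rightarrow> nat trm \<Rightarrow> bool" where
  "replace_second A A' \<longleftrightarrow>
     map_trm (\<lambda>_. ()) A' = map_trm (\<lambda>_. ()) A \<and>
     (\<exists>k < length (sort_vars A). \<exists>j.
        count_list (take k (sort_vars A)) (sort_vars A ! k) = 1 \<and>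
        j \<notin> set (sort_vars A) \<and>
        sort_vars A' = (sort_vars A)[k := j])"

text \<open>
  \<open>S1_args\<close> lists the types of the bound variables \<open>u, v, t, w, z, x\<close> of the axiom S1.

  In \<open>gen_I\<close> the side condition of the new scheme is the derivability of its instances: the
  side condition of the old scheme is dropped except for what this requires. If \<open>A\<close> has no
  second occurrence of a sort variable then \<open>A' = A\<close>, hence the reflexive closure.

  In \<open>gen_II\<close> the sort \<open>s\<close> and the side condition \<open>P\<close> of the old scheme only restrict the
  assignment \<open>\<rho>\<close>. The sort \<open>s'\<close> may be a new sort variable or one that already occurs.
\<close>

definition S1_args :: "nat trm list" where
  "S1_args =
    [Cst 1,
     Pi (Var 0) (Cst 2),
     Pi (Var 1) (Pi (App (Var 1) (Var 0)) (Cst 3)),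
     Pi (Var 2) (Pi (App (Var 2) (Var 0)) (App (App (Var 2) (Var 1)) (Var 0))),
     Pi (Var 3) (App (Var 3) (Var 0)),
     Var 4]"

inductive_set hilbert_schemes :: "'c pts \<Rightarrow> 'c scheme set" for X where
  Pi1: "(\<lambda>\<rho>. (\<rho> 1, \<rho> 2, \<rho> 3) \<in> Rules X,
      lams [Cst 1, Pi (Var 0) (Cst 2)] (Pi (Var 1) (App (Var 1) (Var 0))),
      pis [Cst 1, Pi (Var 0) (Cst 2)] (Cst 3)) \<in> hilbert_schemes X"
| I1: "(\<lambda>\<rho>. True,
      lams [Cst 1, Var 0] (Var 0),
      pis [Cst 1, Var 0] (Var 1)) \<in> hilbert_schemes X"
| K1: "(\<lambda>\<rho>. True,
      lams [Cst 1, Cst 2, Var 1, Var 1] (Var 1),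
      pis [Cst 1, Cst 2, Var 1, Var 1] (Var 3)) \<in> hilbert_schemes X"
| S1: "(\<lambda>\<rho>. True,
      lams S1_args (App (App (Var 2) (Var 0)) (App (Var 1) (Var 0))),
      pis S1_args (App (App (Var 3) (Var 0)) (App (Var 1) (Var 0)))) \<in> hilbert_schemes X"
| gen_I: "\<lbrakk>(P, M, A) \<in> hilbert_schemes X; \<forall>i. A \<noteq> Cst i; replace_second\<^sup>*\<^sup>* A A'\<rbrakk>
    \<Longrightarrow> (\<lambda>\<rho>. pts_theorem X (map_trm \<rho> A') (Cst (\<rho> s)), A', Cst s) \<in> hilbert_schemes X"
| gen_II: "(P, lams As (Pi A B), pis As (Cst s)) \<in> hilbert_schemes X
    \<Longrightarrow> (\<lambda>\<rho>. P \<rho> \<and> pts_theorem X (map_trm \<rho> (lams (As @ [A]) B))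
                                  (map_trm \<rho> (pis (As @ [A]) (Cst s'))),
         lams (As @ [A]) B, pis (As @ [A]) (Cst s')) \<in> hilbert_schemes X"

definition corresponding_hpts :: "'c pts \<Rightarrow> 'c hpts" where
  "corresponding_hpts X =
     \<lparr>HSorts = Sorts X, HAxioms = Axioms X, HSchemes = hilbert_schemes X\<rparr>"

end

theory Submission
  imports Defs "HOL-Library.Confluence"
begin

text \<open>
  Soundness: the instances of the four basic schemes are derivable in the PTS, and the
  remaining rules of the HPTS are admissible there by confluence and subject reduction.

  Completeness: \<open>\<Gamma> \<turnstile> M : A\<close> is interpreted as the HPTS theorem \<open>\<lambda>\<Gamma>. M : \<Pi>\<Gamma>. A\<close>. Under this
  reading (abstraction) is void, I1 gives (start), K1 gives (weakening), \<Pi>1 gives (product), and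
  S1 for the context \<open>\<Gamma>\<close> gives (application) for \<open>\<Gamma>, x:C\<close>, by induction on the length of the
  context. Each use of a combinator requires its type, and the bodies of the products in that type,
  to be typed by sorts in the HPTS itself; this is what the rules (I) and (II) provide. To break the
  circularity between (product) and (application) in \<open>\<Gamma>, x:C\<close>, S1 is first applied to functions
  with a closed type, which yields the products that occur as types in the general case.
\<close>

subsection \<open>Parallel substitution\<close>

text \<open>The obstacle is that (application) in the empty context asks for no sorts, whereas its
  simulation in a context by S1 needs sorts for the types of the arguments. For
  \<open>M : Pi A B\<close> in \<open>C # \<Gamma>\<close> these include \<open>Pi A (Cst b)\<close>
  and \<open>Pi A B\<close>, so application in \<open>C # \<Gamma>\<close> presupposes product
  there, and product is an application of the combinator \<Pi>1 there. The circle breaks because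
  \<Pi>1 is first applied to \<open>A\<close>, whose type \<open>Cst a\<close> is closed: the
  products needed for that step are theorems and can be weakened. The resulting function has the
  type \<open>Pi (Pi A (Cst b)) (Cst e)\<close>. It is no longer closed, but it is the value at
  \<open>A\<close> of a closed function supplied by the rules (I) and (II), so S1 can be used once
  more to apply the function to \<open>Lam A B\<close>. Supersortedness guarantees a sort for every
  constant and for every product of types; hence \<open>pis (rev \<Gamma>) A\<close> has a sort
  whenever \<open>A\<close> has one in \<Gamma>, and conversion is available in context.\<close>

definition up :: "(nat \<Rightarrow> 'c trm) \<Rightarrow> nat \<Rightarrow> 'c trm" where
  "up \<sigma> = case_nat (Var 0) (\<lambda>j. lift (\<sigma> j) 0)"

lemma up_simps [simp]: "up \<sigma> 0 = Var 0" "up \<sigma> (Suc j) = lift (\<sigma> j) 0"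
  by (simp_all add: up_def)

text \<open>Both \<open>lift\<close> and \<open>subst\<close> are instances, so their commutation
  laws reduce to the composition laws of \<open>psubst\<close> and a pointwise comparison of
  substitutions.\<close>

primrec psubst :: "(nat \<Rightarrow> 'c trm) \<Rightarrow> 'c trm \<Rightarrow> 'c trm" where
  "psubst \<sigma> (Var i) = \<sigma> i"
| "psubst \<sigma> (Cst c) = Cst c"
| "psubst \<sigma> (Pi A B) = Pi (psubst \<sigma> A) (psubst (up \<sigma>) B)"
| "psubst \<sigma> (Lam A B) = Lam (psubst \<sigma> A) (psubst (up \<sigma>) B)"
| "psubst \<sigma> (App M N) = App (psubst \<sigma> M) (psubst \<sigma> N)"

lemma up_Var: "up (\<lambda>i. Var (\<xi> i)) = (\<lambda>i. Var (case_nat 0 (\<lambda>j. Suc (\<xi> j)) i))"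
  by (auto simp: up_def fun_eq_iff split: nat.split)

lemma up_lift: "up (\<lambda>i. if i < k then Var i else Var (Suc i))
    = (\<lambda>i. if i < Suc k then Var i else Var (Suc i))"
  by (auto simp: up_def fun_eq_iff split: nat.split)

lemma lift_psubst: "lift M k = psubst (\<lambda>i. if i < k then Var i else Var (Suc i)) M"
  by (induction M arbitrary: k) (auto simp: up_lift)

lemma lift0_psubst: "lift M 0 = psubst (\<lambda>i. Var (Suc i)) M"
  by (simp add: lift_psubst)

lemma up_subst: "up (\<lambda>i. if k < i then Var (i - 1) else if i = k then N else Var i)
    = (\<lambda>i. if Suc k < i then Var (i - 1) else if i = Suc k then lift N 0 else Var i)"
  by (auto simp: up_def fun_eq_iff split: nat.split)

lemma subst_psubst:
  "subst M N k = psubst (\<lambda>i. if k < i then Var (i - 1) else if i = k then N else Var i) M"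
  by (induction M arbitrary: N k) (auto simp: up_subst)

lemma psubst_Var_id:
  fixes M :: "'c trm" shows "psubst Var M = M"
proof -
  have "up Var = (Var :: nat \<Rightarrow> 'c trm)"
    by (auto simp: up_def fun_eq_iff split: nat.split)
  then show ?thesis by (induction M) auto
qed

text \<open>Renamings are composed before general substitutions: under a binder \<open>up\<close>
  lifts the images, and \<open>lift\<close> is itself a renaming, so \<open>psubst_psubst\<close>
  relies on the two renaming cases.\<close>

lemma psubst_rename: "psubst \<sigma> (psubst (\<lambda>i. Var (\<xi> i)) M) = psubst (\<lambda>i. \<sigma> (\<xi> i)) M"
proof (induction M arbitrary: \<sigma> \<xi>)
  case (Pi A B)
  have "(\<lambda>i. up \<sigma> (case_nat 0 (\<lambda>j. Suc (\<xi> j)) i)) = up (\<lambda>i. \<sigma> (\<xi> i))"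
    by (auto simp: fun_eq_iff split: nat.split)
  with Pi show ?case by (simp add: up_Var)
next
  case (Lam A B)
  have "(\<lambda>i. up \<sigma> (case_nat 0 (\<lambda>j. Suc (\<xi> j)) i)) = up (\<lambda>i. \<sigma> (\<xi> i))"
    by (auto simp: fun_eq_iff split: nat.split)
  with Lam show ?case by (simp add: up_Var)
qed auto

lemma psubst_lift: "psubst \<sigma> (lift M 0) = psubst (\<lambda>i. \<sigma> (Suc i)) M"
  by (simp add: lift0_psubst psubst_rename)

lemma rename_psubst:
  "psubst (\<lambda>i. Var (\<xi> i)) (psubst \<sigma> M) = psubst (\<lambda>i. psubst (\<lambda>i. Var (\<xi> i)) (\<sigma> i)) M"
proof (induction M arbitrary: \<sigma> \<xi>)
  case (Pi A B)
  have "(\<lambda>i. psubst (\<lambda>i. Var (case_nat 0 (\<lambda>j. Suc (\<xi> j)) i)) (up \<sigma> i))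
      = up (\<lambda>i. psubst (\<lambda>i. Var (\<xi> i)) (\<sigma> i))"
    by (auto simp: fun_eq_iff lift0_psubst psubst_rename up_def split: nat.split)
  with Pi show ?case by (simp add: up_Var)
next
  case (Lam A B)
  have "(\<lambda>i. psubst (\<lambda>i. Var (case_nat 0 (\<lambda>j. Suc (\<xi> j)) i)) (up \<sigma> i))
      = up (\<lambda>i. psubst (\<lambda>i. Var (\<xi> i)) (\<sigma> i))"
    by (auto simp: fun_eq_iff lift0_psubst psubst_rename up_def split: nat.split)
  with Lam show ?case by (simp add: up_Var)
qed auto

lemma lift_psubst_commute: "lift (psubst \<sigma> M) 0 = psubst (\<lambda>i. lift (\<sigma> i) 0) M"
  by (simp add: lift0_psubst rename_psubst)

lemma psubst_psubst: "psubst \<tau> (psubst \<sigma> M) = psubst (\<lambda>i. psubst \<tau> (\<sigma> i)) M"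
proof (induction M arbitrary: \<sigma> \<tau>)
  case (Pi A B)
  have "(\<lambda>i. psubst (up \<tau>) (up \<sigma> i)) = up (\<lambda>i. psubst \<tau> (\<sigma> i))"
    by (auto simp: fun_eq_iff psubst_lift lift_psubst_commute up_def split: nat.split)
  with Pi show ?case by simp
next
  case (Lam A B)
  have "(\<lambda>i. psubst (up \<tau>) (up \<sigma> i)) = up (\<lambda>i. psubst \<tau> (\<sigma> i))"
    by (auto simp: fun_eq_iff psubst_lift lift_psubst_commute up_def split: nat.split)
  with Lam show ?case by simp
qed auto

lemma subst_lift [simp]: "subst (lift M 0) N 0 = M"
  by (simp add: subst_psubst psubst_lift psubst_Var_id)

lemma subst_lift1_Var [simp]:
  fixes M :: "'c trm" shows "subst (lift M (Suc 0)) (Var 0) 0 = M"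
proof -
  have "(\<lambda>i. psubst (\<lambda>i. if 0 < i then Var (i - 1) else if i = 0 then Var 0 else Var i)
      (if i < Suc 0 then Var i else Var (Suc i))) = (Var :: nat \<Rightarrow> 'c trm)"
    by (auto simp: fun_eq_iff)
  then show ?thesis
    by (simp only: subst_psubst lift_psubst psubst_psubst psubst_Var_id)
qed

lemma psubst_subst:
  "psubst \<sigma> (subst M N 0) = subst (psubst (up \<sigma>) M) (psubst \<sigma> N) 0"
proof -
  have "(\<lambda>i. psubst \<sigma> (if 0 < i then Var (i - 1) else if i = 0 then N else Var i))
      = (\<lambda>i. psubst (\<lambda>i. if 0 < i then Var (i - 1) else if i = 0 then psubst \<sigma> N else Var i)
               (up \<sigma> i))"
    by (auto simp: fun_eq_iff psubst_lift psubst_Var_id up_def split: nat.split)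
  then show ?thesis
    by (simp only: subst_psubst psubst_psubst)
qed

lemma lift_eq_simps:
  "lift M k = Pi A B \<longleftrightarrow> (\<exists>A' B'. M = Pi A' B' \<and> A = lift A' k \<and> B = lift B' (Suc k))"
  "lift M k = Lam A B \<longleftrightarrow> (\<exists>A' B'. M = Lam A' B' \<and> A = lift A' k \<and> B = lift B' (Suc k))"
  "lift M k = App A B \<longleftrightarrow> (\<exists>A' B'. M = App A' B' \<and> A = lift A' k \<and> B = lift B' k)"
  by (cases M; auto)+

lemma lift_subst_distrib: "lift (subst M N 0) k = subst (lift M (Suc k)) (lift N k) 0"
  by (simp only: lift_psubst[where k = k] lift_psubst[where k = "Suc k"] psubst_subst up_lift)

lemma subst_lift_Suc [simp]: "subst (lift M 0) (lift N 0) (Suc k) = lift (subst M N k) 0"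
  by (simp add: subst_psubst psubst_lift lift_psubst_commute)
    (rule arg_cong2[where f = psubst]; auto simp: fun_eq_iff)

lemma lift_lift_Suc: "lift (lift M 0) (Suc k) = lift (lift M k) 0"
  by (simp only: lift_psubst[where k = k] lift_psubst[where k = "Suc k"] psubst_lift lift_psubst_commute)
    (rule arg_cong2[where f = psubst]; auto simp: fun_eq_iff)

subsection \<open>Confluence\<close>

lemma beta_psubst: "beta M N \<Longrightarrow> beta (psubst \<sigma> M) (psubst \<sigma> N)"
proof (induction arbitrary: \<sigma> rule: beta.induct)
  case (beta A M N)
  show ?case using beta.beta by (simp add: psubst_subst)
qed (auto intro: beta.intros)

lemma beta_lift: "beta M N \<Longrightarrow> beta (lift M k) (lift N k)"
  by (simp add: lift_psubst beta_psubst)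

lemma beta_subst: "beta M N \<Longrightarrow> beta (subst M P k) (subst N P k)"
  by (simp add: subst_psubst beta_psubst)

text \<open>Lifting creates no redex. Subject reduction needs this where the last rule is
  \<open>typing.weak\<close> and the reduced term is a lifted one.\<close>

lemma beta_lift_inv: "beta (lift M k) N \<Longrightarrow> \<exists>M'. N = lift M' k \<and> beta M M'"
proof (induction "lift M k" N arbitrary: M k rule: beta.induct)
  case (beta A P N)
  then obtain A' P' N' where "M = App (Lam A' P') N'" "P = lift P' (Suc k)" "N = lift N' k"
    by (metis lift_eq_simps(2,3))
  then show ?case by (metis beta.beta lift_subst_distrib)
next
  case (PiL A A' B)
  then show ?case by (metis beta.PiL lift.simps(3) lift_eq_simps(1))
next
  case (PiR B B' A)
  then show ?case by (metis beta.PiR lift.simps(3) lift_eq_simps(1))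
next
  case (LamL A A' B)
  then show ?case by (metis beta.LamL lift.simps(4) lift_eq_simps(2))
next
  case (LamR B B' A)
  then show ?case by (metis beta.LamR lift.simps(4) lift_eq_simps(2))
next
  case (AppL A A' B)
  then show ?case by (metis beta.AppL lift.simps(5) lift_eq_simps(3))
next
  case (AppR B B' A)
  then show ?case by (metis beta.AppR lift.simps(5) lift_eq_simps(3))
qed

section \<open>Parallel reduction and complete developments\<close>

inductive par :: "'c trm \<Rightarrow> 'c trm \<Rightarrow> bool" where
  Var: "par (Var i) (Var i)"
| Cst: "par (Cst c) (Cst c)"
| Pi: "par A A' \<Longrightarrow> par B B' \<Longrightarrow> par (Pi A B) (Pi A' B')"
| Lam: "par A A' \<Longrightarrow> par B B' \<Longrightarrow> par (Lam A B) (Lam A' B')"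
| App: "par M M' \<Longrightarrow> par N N' \<Longrightarrow> par (App M N) (App M' N')"
| beta: "par M M' \<Longrightarrow> par N N' \<Longrightarrow> par (App (Lam A M) N) (subst M' N' 0)"

inductive_cases par_VarE: "par (Var i) N"
inductive_cases par_CstE: "par (Cst c) N"
inductive_cases par_PiE: "par (Pi A B) N"
inductive_cases par_LamE: "par (Lam A B) N"
inductive_cases par_AppE: "par (App A B) N"

lemma par_refl [simp]: "par M M"
  by (induction M) (auto intro: par.intros)

lemma beta_imp_par: "beta M N \<Longrightarrow> par M N"
  by (induction rule: beta.induct) (auto intro: par.intros)

lemma beta_rtranclp_cong:
  fixes A :: "'c trm"
  shows "beta\<^sup>*\<^sup>* A A' \<Longrightarrow> beta\<^sup>*\<^sup>* B B' \<Longrightarrow> beta\<^sup>*\<^sup>* (Pi A B) (Pi A' B')"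
  "beta\<^sup>*\<^sup>* A A' \<Longrightarrow> beta\<^sup>*\<^sup>* B B' \<Longrightarrow> beta\<^sup>*\<^sup>* (Lam A B) (Lam A' B')"
  "beta\<^sup>*\<^sup>* A A' \<Longrightarrow> beta\<^sup>*\<^sup>* B B' \<Longrightarrow> beta\<^sup>*\<^sup>* (App A B) (App A' B')"
proof -
  have left: "beta\<^sup>*\<^sup>* (f A B) (f A' B)"
      if "\<And>A A'. beta A A' \<Longrightarrow> beta (f A B) (f A' B)" "beta\<^sup>*\<^sup>* A A'"
    for f :: "'c trm \<Rightarrow> 'c trm \<Rightarrow> 'c trm" and A A' B
    using that(2) by induction (auto intro: that(1) rtranclp.rtrancl_into_rtrancl)
  show "beta\<^sup>*\<^sup>* A A' \<Longrightarrow> beta\<^sup>*\<^sup>* B B' \<Longrightarrow> beta\<^sup>*\<^sup>* (Pi A B) (Pi A' B')"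
    using left[of Pi B A A', OF beta.PiL] left[of "\<lambda>x y. Pi y x" A' B B', OF beta.PiR]
    by (metis rtranclp_trans)
  show "beta\<^sup>*\<^sup>* A A' \<Longrightarrow> beta\<^sup>*\<^sup>* B B' \<Longrightarrow> beta\<^sup>*\<^sup>* (Lam A B) (Lam A' B')"
    using left[of Lam B A A', OF beta.LamL] left[of "\<lambda>x y. Lam y x" A' B B', OF beta.LamR]
    by (metis rtranclp_trans)
  show "beta\<^sup>*\<^sup>* A A' \<Longrightarrow> beta\<^sup>*\<^sup>* B B' \<Longrightarrow> beta\<^sup>*\<^sup>* (App A B) (App A' B')"
    using left[of App B A A', OF beta.AppL] left[of "\<lambda>x y. App y x" A' B B', OF beta.AppR]
    by (metis rtranclp_trans)
qed

lemma par_imp_betas: "par M N \<Longrightarrow> beta\<^sup>*\<^sup>* M N"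
proof (induction rule: par.induct)
  case (beta M M' N N' A)
  have "beta\<^sup>*\<^sup>* (App (Lam A M) N) (App (Lam A M') N')"
    using beta.IH by (intro beta_rtranclp_cong) auto
  also have "beta (App (Lam A M') N') (subst M' N' 0)" by (rule beta.beta)
  finally show ?case .
qed (auto intro: beta_rtranclp_cong)

lemma par_rename: "par M N \<Longrightarrow> par (psubst (\<lambda>i. Var (\<xi> i)) M) (psubst (\<lambda>i. Var (\<xi> i)) N)"
proof (induction arbitrary: \<xi> rule: par.induct)
  case (beta M M' N N' A)
  show ?case
    using par.beta[OF beta.IH(1)[of "case_nat 0 (\<lambda>j. Suc (\<xi> j))"] beta.IH(2)[of \<xi>]]
    by (simp add: psubst_subst up_Var)
qed (auto intro: par.intros simp: up_Var)

lemma par_up: "(\<And>i. par (\<sigma> i) (\<sigma>' i)) \<Longrightarrow> par (up \<sigma> i) (up \<sigma>' i)"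
  by (cases i) (auto simp: lift0_psubst intro: par_rename)

lemma par_psubst:
  "par M M' \<Longrightarrow> (\<And>i. par (\<sigma> i) (\<sigma>' i)) \<Longrightarrow> par (psubst \<sigma> M) (psubst \<sigma>' M')"
proof (induction arbitrary: \<sigma> \<sigma>' rule: par.induct)
  case (beta M M' N N' A)
  have "par (psubst (up \<sigma>) M) (psubst (up \<sigma>') M')" "par (psubst \<sigma> N) (psubst \<sigma>' N')"
    using beta.prems by (intro beta.IH par_up; simp)+
  then show ?case by (simp add: psubst_subst par.beta)
qed (simp_all add: par.intros par_up)

lemma par_subst: "par M M' \<Longrightarrow> par N N' \<Longrightarrow> par (subst M N k) (subst M' N' k)"
  by (auto simp: subst_psubst intro: par_psubst)

fun develop :: "'c trm \<Rightarrow> 'c trm" where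
  "develop (Var i) = Var i"
| "develop (Cst c) = Cst c"
| "develop (Pi A B) = Pi (develop A) (develop B)"
| "develop (Lam A B) = Lam (develop A) (develop B)"
| "develop (App (Lam A M) N) = subst (develop M) (develop N) 0"
| "develop (App M N) = App (develop M) (develop N)"

text \<open>Takahashi's triangle property: \<open>develop M\<close> contracts all redexes of
  \<open>M\<close> at once, so every parallel reduct of \<open>M\<close> reduces to it in one
  parallel step, and two reducts are joined there.\<close>

lemma par_develop: "par M N \<Longrightarrow> par N (develop M)"
proof (induction M arbitrary: N rule: develop.induct)
  case (5 A M N')
  from "5.prems" show ?case
    by (rule par_AppE) (auto elim!: par_LamE intro!: par.beta par_subst dest: "5.IH")
next
  case ("6_1" v N')
  then show ?case by (auto elim!: par_AppE intro!: par.App)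
next
  case ("6_2" v N')
  then show ?case by (auto elim!: par_AppE intro!: par.App)
next
  case ("6_3" v w N')
  then show ?case by (auto elim!: par_AppE intro!: par.App)
next
  case ("6_4" v w N')
  from "6_4.prems" show ?case by (rule par_AppE) (auto intro!: par.App dest: "6_4.IH")
qed (auto elim!: par_VarE par_CstE par_PiE par_LamE intro: par.intros)

lemma par_betas: "par\<^sup>*\<^sup>* = (beta\<^sup>*\<^sup>* :: 'c trm \<Rightarrow> _)"
proof (rule antisym; intro predicate2I)
  fix M N :: "'c trm"
  show "par\<^sup>*\<^sup>* M N \<Longrightarrow> beta\<^sup>*\<^sup>* M N"
    by (induction rule: rtranclp_induct) (auto dest: par_imp_betas)
  show "beta\<^sup>*\<^sup>* M N \<Longrightarrow> par\<^sup>*\<^sup>* M N"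
    by (metis beta_imp_par mono_rtranclp)
qed

lemma beta_confluent: "confluentp (beta :: 'c trm \<Rightarrow> _)"
proof -
  have "strong_confluentp (par :: 'c trm \<Rightarrow> _)"
    by (rule strong_confluentpI) (meson par_develop r_into_rtranclp sup2I1)
  then have "confluentp (par :: 'c trm \<Rightarrow> _)"
    by (rule strong_confluentp_imp_confluentp)
  then show ?thesis by (metis confluentpI confluentpD par_betas)
qed

lemma beta_conv_join:
  "beta_conv M N \<Longrightarrow> \<exists>P. beta\<^sup>*\<^sup>* M P \<and> beta\<^sup>*\<^sup>* N P"
  using semiconfluentp_equivclp[OF confluentp_imp_semiconfluentp[OF beta_confluent]]
  by (metis conversepD relcomppE rtranclp_conversep)

lemma betas_Pi: "beta\<^sup>*\<^sup>* (Pi A B) P \<Longrightarrow> \<exists>A' B'. P = Pi A' B' \<and> beta\<^sup>*\<^sup>* A A' \<and> beta\<^sup>*\<^sup>* B B'"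
proof (induction rule: rtranclp_induct)
  case (step P Q)
  then obtain A' B' where P: "P = Pi A' B'" "beta\<^sup>*\<^sup>* A A'" "beta\<^sup>*\<^sup>* B B'" by blast
  from step(2) P show ?case
    by (auto elim!: beta.cases[of "Pi A' B'"] intro: rtranclp.rtrancl_into_rtrancl)
qed auto

lemma betas_imp_conv: "beta\<^sup>*\<^sup>* M N \<Longrightarrow> beta_conv M N"
  by (rule rtranclp_into_equivclp)

text \<open>Confluence makes products injective up to conversion, since a product reduces only
  componentwise. Subject reduction for a contracted redex rests on this.\<close>

lemma beta_conv_Pi:
  assumes "beta_conv (Pi A B) (Pi A' B')" shows "beta_conv A A'" "beta_conv B B'"
  using beta_conv_join[OF assms]
  by (auto dest!: betas_Pi) (meson betas_imp_conv equivclp_sym equivclp_trans)+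

lemma beta_conv_map:
  assumes "beta_conv M N" "\<And>M N. beta M N \<Longrightarrow> beta (f M) (f N)"
  shows "beta_conv (f M) (f N)"
  using assms(1)
proof (induction rule: equivclp_induct)
  case (step y z)
  then show ?case using assms(2) by (metis equivclp_into_equivclp)
qed simp

lemma beta_conv_psubst: "beta_conv M N \<Longrightarrow> beta_conv (psubst \<sigma> M) (psubst \<sigma> N)"
  by (erule beta_conv_map) (rule beta_psubst)

lemma beta_conv_subst: "beta_conv M N \<Longrightarrow> beta_conv (subst M P k) (subst N P k)"
  by (erule beta_conv_map) (rule beta_subst)

lemma beta_conv_lift: "beta_conv M N \<Longrightarrow> beta_conv (lift M k) (lift N k)"
  by (erule beta_conv_map) (rule beta_lift)

lemma beta_conv_subst_arg: "beta N N' \<Longrightarrow> beta_conv (subst B N k) (subst B N' k)"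
  by (intro betas_imp_conv par_imp_betas par_subst beta_imp_par par_refl)

lemma beta_lams: "beta M N \<Longrightarrow> beta (lams As M) (lams As N)"
  and beta_pis: "beta M N \<Longrightarrow> beta (pis As M) (pis As N)"
  by (induction As) (auto intro: beta.intros)

subsection \<open>Metatheory of supersorted pure type systems\<close>

locale supersorted_pts =
  fixes X :: "'c pts"
  assumes is_pts: "is_pts X" and supersorted: "supersorted X"
begin

lemma ex_axiom: "\<exists>s\<in>Sorts X. (c, s) \<in> Axioms X"
  using supersorted by (auto simp: supersorted_def)

lemma ex_rule:
  "s1 \<in> Sorts X \<Longrightarrow> s2 \<in> Sorts X \<Longrightarrow> \<exists>s3\<in>Sorts X. (s1, s2, s3) \<in> Rules X"
  using supersorted by (auto simp: supersorted_def)

lemma rule_sorts: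
  "(s1, s2, s3) \<in> Rules X \<Longrightarrow> s1 \<in> Sorts X"
  "(s1, s2, s3) \<in> Rules X \<Longrightarrow> s2 \<in> Sorts X"
  "(s1, s2, s3) \<in> Rules X \<Longrightarrow> s3 \<in> Sorts X"
  using is_pts by (auto simp: is_pts_def)

text \<open>
  The same judgement as in the PTS, with redundant premises that make the types of all
  types involved available as subderivations. Inductions over it need neither generation
  nor correctness of types.
\<close>

inductive typing :: "'c trm list \<Rightarrow> 'c trm \<Rightarrow> 'c trm \<Rightarrow> bool" where
  ax: "(c, s) \<in> Axioms X \<Longrightarrow> typing [] (Cst c) (Cst s)"
| start: "\<lbrakk>typing \<Gamma> A (Cst s); s \<in> Sorts X\<rbrakk> \<Longrightarrow> typing (A # \<Gamma>) (Var 0) (lift A 0)"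
| weak: "\<lbrakk>typing \<Gamma> M B; typing \<Gamma> B (Cst b); b \<in> Sorts X; typing \<Gamma> A (Cst a); a \<in> Sorts X\<rbrakk>
    \<Longrightarrow> typing (A # \<Gamma>) (lift M 0) (lift B 0)"
| app: "\<lbrakk>typing \<Gamma> M (Pi A B); typing \<Gamma> N A; typing \<Gamma> A (Cst a); a \<in> Sorts X;
      typing (A # \<Gamma>) B (Cst b); b \<in> Sorts X\<rbrakk>
    \<Longrightarrow> typing \<Gamma> (App M N) (subst B N 0)"
| lam: "\<lbrakk>typing (A # \<Gamma>) M B; typing \<Gamma> A (Cst a); a \<in> Sorts X; typing (A # \<Gamma>) B (Cst b); b \<in> Sorts X\<rbrakk>
    \<Longrightarrow> typing \<Gamma> (Lam A M) (Pi A B)"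
| prod: "\<lbrakk>typing \<Gamma> A (Cst s1); typing (A # \<Gamma>) B (Cst s2); (s1, s2, s3) \<in> Rules X\<rbrakk>
    \<Longrightarrow> typing \<Gamma> (Pi A B) (Cst s3)"
| conv: "\<lbrakk>typing \<Gamma> M A; typing \<Gamma> B (Cst s); s \<in> Sorts X; beta_conv A B\<rbrakk> \<Longrightarrow> typing \<Gamma> M B"

definition is_type :: "'c trm list \<Rightarrow> 'c trm \<Rightarrow> bool" where
  "is_type \<Gamma> A \<longleftrightarrow> (\<exists>s\<in>Sorts X. typing \<Gamma> A (Cst s))"

primrec wf_ctx :: "'c trm list \<Rightarrow> bool" where
  "wf_ctx [] \<longleftrightarrow> True"
| "wf_ctx (A # \<Gamma>) \<longleftrightarrow> wf_ctx \<Gamma> \<and> is_type \<Gamma> A"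

lemma is_typeI: "typing \<Gamma> A (Cst s) \<Longrightarrow> s \<in> Sorts X \<Longrightarrow> is_type \<Gamma> A"
  by (auto simp: is_type_def)

lemma typing_weak: "typing \<Gamma> M B \<Longrightarrow> is_type \<Gamma> B \<Longrightarrow> is_type \<Gamma> A \<Longrightarrow> typing (A # \<Gamma>) (lift M 0) (lift B 0)"
  by (auto simp: is_type_def intro: typing.weak)

lemma typing_start: "is_type \<Gamma> A \<Longrightarrow> typing (A # \<Gamma>) (Var 0) (lift A 0)"
  by (auto simp: is_type_def intro: typing.start)

lemma typing_app:
  "typing \<Gamma> M (Pi A B) \<Longrightarrow> typing \<Gamma> N A \<Longrightarrow> is_type \<Gamma> A \<Longrightarrow> is_type (A # \<Gamma>) B
    \<Longrightarrow> typing \<Gamma> (App M N) (subst B N 0)"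
  by (auto simp: is_type_def intro: typing.app)

lemma typing_lam:
  "typing (A # \<Gamma>) M B \<Longrightarrow> is_type \<Gamma> A \<Longrightarrow> is_type (A # \<Gamma>) B \<Longrightarrow> typing \<Gamma> (Lam A M) (Pi A B)"
  by (auto simp: is_type_def intro: typing.lam)

lemma is_type_Pi: "is_type \<Gamma> A \<Longrightarrow> is_type (A # \<Gamma>) B \<Longrightarrow> is_type \<Gamma> (Pi A B)"
  using ex_rule unfolding is_type_def by (blast intro: typing.prod)

lemma typing_conv: "typing \<Gamma> M A \<Longrightarrow> is_type \<Gamma> B \<Longrightarrow> beta_conv A B \<Longrightarrow> typing \<Gamma> M B"
  by (auto simp: is_type_def intro: typing.conv)

text \<open>\<open>typing.ax\<close> lives in the empty context, and \<open>typing.weak\<close> also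
  asks for a type of the type \<open>Cst s\<close>; in a supersorted system the constant
  \<open>s\<close> has an axiom of its own.\<close>

lemma typing_Cst: "wf_ctx \<Gamma> \<Longrightarrow> (c, s) \<in> Axioms X \<Longrightarrow> typing \<Gamma> (Cst c) (Cst s)"
proof (induction \<Gamma> arbitrary: c s)
  case (Cons A \<Gamma>)
  obtain b where "b \<in> Sorts X" "(s, b) \<in> Axioms X" using ex_axiom by blast
  then have "is_type \<Gamma> (Cst s)" using Cons by (auto intro: is_typeI)
  then show ?case using typing_weak[of \<Gamma> "Cst c" "Cst s" A] Cons by simp
qed (auto intro: typing.ax)

lemma is_type_Cst: "wf_ctx \<Gamma> \<Longrightarrow> is_type \<Gamma> (Cst c)"
  using ex_axiom[of c] by (auto intro: is_typeI typing_Cst)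

lemma is_type_weak: "wf_ctx \<Gamma> \<Longrightarrow> is_type \<Gamma> B \<Longrightarrow> is_type \<Gamma> A \<Longrightarrow> is_type (A # \<Gamma>) (lift B 0)"
  using typing_weak[of \<Gamma> B "Cst s" A for s] is_type_Cst[of \<Gamma>] by (auto simp: is_type_def)

lemma typing_wf_ctx: "typing \<Gamma> M A \<Longrightarrow> wf_ctx \<Gamma>"
  by (induction rule: typing.induct) (auto intro: is_typeI)

text \<open>The conjunct with \<open>is_type\<close> is kept because pushing \<sigma> under a binder
  weakens its images, and \<open>typing.weak\<close> requires their types to be typed.\<close>

primrec typing_subst :: "'c trm list \<Rightarrow> 'c trm list \<Rightarrow> (nat \<Rightarrow> 'c trm) \<Rightarrow> bool" where
  "typing_subst \<Delta> [] \<sigma> \<longleftrightarrow> True"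
| "typing_subst \<Delta> (A # \<Gamma>) \<sigma> \<longleftrightarrow> typing \<Delta> (\<sigma> 0) (psubst (\<lambda>i. \<sigma> (Suc i)) A) \<and>
     is_type \<Delta> (psubst (\<lambda>i. \<sigma> (Suc i)) A) \<and> typing_subst \<Delta> \<Gamma> (\<lambda>i. \<sigma> (Suc i))"

lemma typing_subst_lift:
  assumes "wf_ctx \<Delta>" "is_type \<Delta> C"
  shows "typing_subst \<Delta> \<Gamma> \<sigma> \<Longrightarrow> typing_subst (C # \<Delta>) \<Gamma> (\<lambda>i. lift (\<sigma> i) 0)"
proof (induction \<Gamma> arbitrary: \<sigma>)
  case (Cons A \<Gamma>)
  then show ?case
    using assms by (auto simp flip: lift_psubst_commute intro: typing_weak is_type_weak)
qed simp

lemma typing_subst_up: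
  assumes "wf_ctx \<Delta>" "is_type \<Delta> (psubst \<sigma> A)" "typing_subst \<Delta> \<Gamma> \<sigma>"
  shows "typing_subst (psubst \<sigma> A # \<Delta>) (A # \<Gamma>) (up \<sigma>)"
  using assms typing_subst_lift[OF assms]
  by (auto simp flip: lift_psubst_commute intro: typing_start is_type_weak)

text \<open>Substitution of a term, insertion of a declaration below the head and conversion in the
  context are all obtained from this with suitable \<sigma>.\<close>

theorem typing_psubst:
  "typing \<Gamma> M A \<Longrightarrow> wf_ctx \<Delta> \<Longrightarrow> typing_subst \<Delta> \<Gamma> \<sigma> \<Longrightarrow> typing \<Delta> (psubst \<sigma> M) (psubst \<sigma> A)"
proof (induction arbitrary: \<Delta> \<sigma> rule: typing.induct)
  case (ax c s)
  then show ?case by (simp add: typing_Cst)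
next
  case (start \<Gamma> A s)
  then show ?case by (simp add: psubst_lift)
next
  case (weak \<Gamma> M B b A a)
  then show ?case by (simp add: psubst_lift)
next
  case (app \<Gamma> M A B N a b)
  note IH = app.IH(1-3)[OF app.prems]
  have A: "is_type \<Delta> (psubst \<sigma> A)" using IH(3) app.hyps by (simp add: is_typeI)
  note up = typing_subst_up[OF app.prems(1) A app.prems(2)]
  have "typing (psubst \<sigma> A # \<Delta>) (psubst (up \<sigma>) B) (Cst b)"
    using app.IH(4)[OF _ up] app.prems A by simp
  then show ?case unfolding psubst_subst psubst.simps using IH app.hyps
    by (metis psubst.simps(2,3) typing.app)
next
  case (lam A \<Gamma> M B a b)
  note IH = lam.IH(2)[OF lam.prems]
  have A: "is_type \<Delta> (psubst \<sigma> A)" using IH lam.hyps by (simp add: is_typeI)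
  note up = typing_subst_up[OF lam.prems(1) A lam.prems(2)]
  show ?case using lam.IH(1,3)[OF _ up] IH lam.prems A lam.hyps(3,5)
    by (simp add: typing.lam)
next
  case (prod \<Gamma> A s1 B s2 s3)
  note IH = prod.IH(1)[OF prod.prems]
  have A: "is_type \<Delta> (psubst \<sigma> A)" using IH prod.hyps rule_sorts by (simp add: is_typeI)
  note up = typing_subst_up[OF prod.prems(1) A prod.prems(2)]
  show ?case using prod.IH(2)[OF _ up] IH prod.prems A prod.hyps(3)
    by (simp add: typing.prod)
next
  case (conv \<Gamma> M A B s)
  note IH = conv.IH[OF conv.prems]
  show ?case using typing.conv[OF IH(1) _ conv.hyps(3) beta_conv_psubst[OF conv.hyps(4)]] IH(2)
    by simp
qed

lemma typing_subst_id: "wf_ctx \<Gamma> \<Longrightarrow> typing_subst \<Gamma> \<Gamma> Var"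
proof (induction \<Gamma>)
  case (Cons A \<Gamma>)
  then have "typing_subst (A # \<Gamma>) \<Gamma> (\<lambda>i. lift (Var i) 0)" by (intro typing_subst_lift) auto
  then show ?case using Cons typing_start[of \<Gamma> A] is_type_weak[of \<Gamma> A A]
    by (simp add: lift0_psubst)
qed simp

lemma typing_subst_single:
  assumes "wf_ctx \<Gamma>" "typing \<Gamma> N A" "is_type \<Gamma> A"
  shows "typing_subst \<Gamma> (A # \<Gamma>) (\<lambda>i. if 0 < i then Var (i - 1) else if i = 0 then N else Var i)"
  using assms typing_subst_id by (simp add: psubst_Var_id)

lemma typing_substitution:
  assumes "typing (A # \<Gamma>) M B" "typing \<Gamma> N A"
  shows "typing \<Gamma> (subst M N 0) (subst B N 0)"
  using typing_psubst[OF assms(1) _ typing_subst_single] typing_wf_ctx[OF assms(1)] assms(2)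
  by (simp add: subst_psubst)

lemma is_type_subst: "is_type (A # \<Gamma>) B \<Longrightarrow> typing \<Gamma> N A \<Longrightarrow> is_type \<Gamma> (subst B N 0)"
  using typing_substitution[of A \<Gamma> B "Cst s" N for s] by (auto simp: is_type_def)

text \<open>The identity is a well-typed substitution from \<open>A # \<Gamma>\<close> to
  \<open>A' # \<Gamma>\<close>: only \<open>Var 0\<close> changes its type, and (conversion)
  restores it.\<close>

lemma typing_ctx_conv:
  assumes "typing (A # \<Gamma>) M B" "is_type \<Gamma> A'" "beta_conv A A'"
  shows "typing (A' # \<Gamma>) M B"
proof -
  have wf: "wf_ctx \<Gamma>" "is_type \<Gamma> A" using typing_wf_ctx[OF assms(1)] by auto
  have A: "is_type (A' # \<Gamma>) (lift A 0)" using wf assms(2) by (intro is_type_weak)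
  have "typing_subst (A' # \<Gamma>) \<Gamma> (\<lambda>i. lift (Var i) 0)"
    using wf assms(2) by (intro typing_subst_lift typing_subst_id)
  moreover have "typing (A' # \<Gamma>) (Var 0) (lift A 0)"
    using typing_start[OF assms(2)] A assms(3) by (meson typing_conv beta_conv_lift equivclp_sym)
  ultimately have "typing_subst (A' # \<Gamma>) (A # \<Gamma>) Var" using A by (simp add: lift0_psubst)
  from typing_psubst[OF assms(1) _ this] show ?thesis using wf assms(2) by (simp add: psubst_Var_id)
qed

lemma typing_correct: "typing \<Gamma> M A \<Longrightarrow> is_type \<Gamma> A"
proof (induction rule: typing.induct)
  case (ax c s)
  then show ?case by (simp add: is_type_Cst)
next
  case (start \<Gamma> A s)
  then show ?case by (metis is_typeI is_type_weak typing_wf_ctx)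
next
  case (weak \<Gamma> M B b A a)
  then show ?case by (metis is_typeI is_type_weak typing_wf_ctx)
next
  case (app \<Gamma> M A B N a b)
  then show ?case by (metis is_typeI is_type_subst)
next
  case (lam A \<Gamma> M B a b)
  then show ?case by (metis is_typeI is_type_Pi)
next
  case (prod \<Gamma> A s1 B s2 s3)
  then show ?case by (metis typing_wf_ctx is_type_Cst)
next
  case (conv \<Gamma> M A B s)
  then show ?case by (metis is_typeI)
qed

text \<open>For the generation lemmas: the last rule may be (weakening), and then the body of the
  binder has to be weakened below its own declaration.\<close>

lemma typing_lift1:
  assumes "typing (A # \<Gamma>) M B" "is_type \<Gamma> C"
  shows "typing (lift A 0 # C # \<Gamma>) (lift M (Suc 0)) (lift B (Suc 0))"
proof -
  have wf: "wf_ctx \<Gamma>" "is_type \<Gamma> A" using typing_wf_ctx[OF assms(1)] by auto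
  have "typing_subst (C # \<Gamma>) \<Gamma> (\<lambda>i. lift (Var i) 0)"
    using wf assms(2) by (intro typing_subst_lift typing_subst_id)
  moreover have C: "wf_ctx (C # \<Gamma>)" "is_type (C # \<Gamma>) (lift A 0)"
    using wf assms(2) by (auto intro: is_type_weak)
  ultimately have "typing_subst (lift A 0 # C # \<Gamma>) (A # \<Gamma>) (up (\<lambda>i. Var (Suc i)))"
    using typing_subst_up[of "C # \<Gamma>" "\<lambda>i. Var (Suc i)" A \<Gamma>] by (simp add: lift0_psubst)
  from typing_psubst[OF assms(1) _ this] C
  have "typing (lift A 0 # C # \<Gamma>) (psubst (up (\<lambda>i. Var (Suc i))) M) (psubst (up (\<lambda>i. Var (Suc i))) B)"
    by simp
  moreover have "up (\<lambda>i. Var (Suc i)) = (\<lambda>i. if i < Suc 0 then Var i else Var (Suc i) :: 'c trm)"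
    by (auto simp: up_def fun_eq_iff split: nat.split)
  ultimately show ?thesis by (simp add: lift_psubst)
qed

lemma gen_Pi: "typing \<Gamma> (Pi A B) T \<Longrightarrow> is_type \<Gamma> A \<and> is_type (A # \<Gamma>) B"
proof (induction \<Gamma> "Pi A B" T arbitrary: A B rule: typing.induct)
  case (weak \<Gamma> M0 T b C a)
  then obtain A' B' where AB: "A = lift A' 0" "B = lift B' (Suc 0)" "is_type \<Gamma> A'"
      "is_type (A' # \<Gamma>) B'"
    by (metis lift_eq_simps(1))
  have "is_type \<Gamma> C" "wf_ctx \<Gamma>" using weak by (auto intro: is_typeI typing_wf_ctx)
  with AB typing_lift1[of A' \<Gamma> B' "Cst s" C for s] show ?case
    by (auto simp: is_type_def[of "_ # _ # _"] is_type_def[of "A' # \<Gamma>"] intro: is_type_weak)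
qed (auto intro: is_typeI dest: rule_sorts)

lemma gen_Lam:
  "typing \<Gamma> (Lam A M) T \<Longrightarrow>
    is_type \<Gamma> A \<and> (\<exists>B. typing (A # \<Gamma>) M B \<and> beta_conv (Pi A B) T)"
proof (induction \<Gamma> "Lam A M" T arbitrary: A M rule: typing.induct)
  case (weak \<Gamma> M0 T b C a)
  then obtain A' M' B' where *: "A = lift A' 0" "M = lift M' (Suc 0)" "is_type \<Gamma> A'"
      "typing (A' # \<Gamma>) M' B'" "beta_conv (Pi A' B') T"
    by (metis lift_eq_simps(2))
  have C: "is_type \<Gamma> C" "wf_ctx \<Gamma>" using weak by (auto intro: is_typeI typing_wf_ctx)
  have "beta_conv (Pi A (lift B' (Suc 0))) (lift T 0)"
    using beta_conv_lift[OF *(5), of 0] * by simp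
  with * C typing_lift1[OF *(4) C(1)] show ?case by (auto intro: is_type_weak)
next
  case (conv \<Gamma> T T' s)
  then show ?case by (meson equivclp_trans)
qed (auto intro: is_typeI)

theorem subject_reduction: "typing \<Gamma> M A \<Longrightarrow> beta M N \<Longrightarrow> typing \<Gamma> N A"
proof (induction arbitrary: N rule: typing.induct)
  case (weak \<Gamma> M B b A a)
  then show ?case by (metis beta_lift_inv typing.weak)
next
  case (app \<Gamma> M A B P a b)
  have types: "is_type \<Gamma> A" "is_type (A # \<Gamma>) B" using app by (auto intro: is_typeI)
  have BP: "is_type \<Gamma> (subst B P 0)" using types app.hyps by (auto intro: is_type_subst)
  consider (1) A0 M0 where "M = Lam A0 M0" "N = subst M0 P 0"
    | (2) M' where "N = App M' P" "beta M M'" | (3) P' where "N = App M P'" "beta P P'"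
    using app.prems by (cases rule: beta.cases) auto
  then show ?case
  proof cases
    case 1
    with gen_Lam[of \<Gamma> A0 M0 "Pi A B"] app.hyps obtain B0 where
      *: "is_type \<Gamma> A0" "typing (A0 # \<Gamma>) M0 B0" "beta_conv (Pi A0 B0) (Pi A B)" by auto
    \<comment> \<open>Injectivity of products moves the argument to the domain \<open>A0\<close> of
      the redex; the type of the contractum is converted back to \<open>subst B P 0\<close>
      afterwards.\<close>
    have "typing \<Gamma> P A0" using * app.hyps beta_conv_Pi(1) typing_conv equivclp_sym by metis
    then have "typing \<Gamma> (subst M0 P 0) (subst B0 P 0)" using * typing_substitution by blast
    then show ?thesis using 1 BP beta_conv_subst[OF beta_conv_Pi(2)[OF *(3)]] typing_conv by blast
  next
    case 2
    then show ?thesis using app types by (auto intro: typing_app)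
  next
    case 3
    \<comment> \<open>A step inside the argument changes the type to \<open>subst B P' 0\<close>,
      which is then converted back.\<close>
    then have "typing \<Gamma> (App M P') (subst B P' 0)" using app types by (auto intro: typing_app)
    then show ?thesis
      using 3 BP beta_conv_subst_arg[of P P' B 0] by (meson equivclp_sym typing_conv)
  qed
next
  case (lam A \<Gamma> M B a b)
  have types: "is_type \<Gamma> A" "is_type (A # \<Gamma>) B" using lam by (auto intro: is_typeI)
  consider (1) A' where "N = Lam A' M" "beta A A'" | (2) M' where "N = Lam A M'" "beta M M'"
    using lam.prems by (cases rule: beta.cases) auto
  then show ?case
  proof cases
    case 1
    have A': "is_type \<Gamma> A'" using lam 1 by (auto intro: is_typeI)
    have "typing (A' # \<Gamma>) M B" "is_type (A' # \<Gamma>) B"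
      using typing_ctx_conv[of A \<Gamma> _ _ A'] lam 1 A' by (auto intro: is_typeI)
    then have "typing \<Gamma> (Lam A' M) (Pi A' B)" using A' by (intro typing_lam)
    moreover have "beta_conv (Pi A' B) (Pi A B)" using 1 by (auto intro: beta.PiL)
    ultimately show ?thesis using 1 is_type_Pi[OF types] typing_conv by blast
  next
    case 2
    then show ?thesis using lam types by (auto intro: typing_lam)
  qed
next
  case (prod \<Gamma> A s1 B s2 s3)
  consider (1) A' where "N = Pi A' B" "beta A A'" | (2) B' where "N = Pi A B'" "beta B B'"
    using prod.prems by (cases rule: beta.cases) auto
  then show ?case
  proof cases
    case 1
    then have A': "typing \<Gamma> A' (Cst s1)" using prod by auto
    have "typing (A' # \<Gamma>) B (Cst s2)"
      using typing_ctx_conv[OF prod.hyps(2)] A' 1(2) is_typeI rule_sorts(1)[OF prod.hyps(3)]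
        by blast
    with A' show ?thesis using 1 prod by (auto intro: typing.prod)
  next
    case 2
    then show ?thesis using prod by (auto intro: typing.prod)
  qed
qed (auto elim: beta.cases intro: typing.conv)

lemma typing_type_reduction: "typing \<Gamma> M A \<Longrightarrow> beta A B \<Longrightarrow> typing \<Gamma> M B"
  by (metis is_type_def r_into_equivclp subject_reduction typing_conv typing_correct)

text \<open>Correctness of types and \<open>gen_Pi\<close> recover the redundant premises;
  conversely, the sort of \<open>Pi A B\<close> required by (abstraction) exists because the system
  is supersorted.\<close>

lemma typing_iff_pts_typing: "typing \<Gamma> M A \<longleftrightarrow> pts_typing X \<Gamma> M A"
proof
  show "typing \<Gamma> M A \<Longrightarrow> pts_typing X \<Gamma> M A"
  proof (induction rule: typing.induct)
    case (lam A \<Gamma> M B a b)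
    then show ?case using ex_rule[of a b] by (metis pts_typing.abstraction pts_typing.product)
  qed (auto intro: pts_typing.intros)
next
  show "pts_typing X \<Gamma> M A \<Longrightarrow> typing \<Gamma> M A"
  proof (induction rule: pts_typing.induct)
    case (ax c s)
    then show ?case by (rule typing.ax)
  next
    case (start \<Gamma> A s)
    then show ?case by (auto intro: typing.start)
  next
    case (weakening \<Gamma> M B A s)
    then show ?case by (metis typing_weak typing_correct is_typeI)
  next
    case (application \<Gamma> M A B N)
    then show ?case by (metis gen_Pi is_type_def typing_app typing_correct)
  next
    case (abstraction A \<Gamma> M B s)
    then show ?case by (metis gen_Pi typing_lam)
  next
    case (product \<Gamma> A s1 B s2 s3)
    then show ?case by (auto intro: typing.prod)
  next
    case (conversion \<Gamma> M A B s)
    then show ?case by (auto intro: typing.conv)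
  qed
qed

subsection \<open>Soundness of the Hilbert-style system\<close>

lemma typing_abstraction: "typing (A # \<Gamma>) M B \<Longrightarrow> typing \<Gamma> (Lam A M) (Pi A B)"
  using typing_wf_ctx typing_correct typing_lam by force

lemma typing_application:
  "typing \<Gamma> M (Pi A B) \<Longrightarrow> typing \<Gamma> N A \<Longrightarrow> T = subst B N 0 \<Longrightarrow> typing \<Gamma> (App M N) T"
  using gen_Pi typing_correct typing_app by (metis is_type_def)

lemma typing_Var:
  "wf_ctx \<Gamma> \<Longrightarrow> i < length \<Gamma> \<Longrightarrow> T = ((\<lambda>M. lift M 0) ^^ Suc i) (\<Gamma> ! i) \<Longrightarrow> typing \<Gamma> (Var i) T"
proof (induction \<Gamma> arbitrary: i T)
  case (Cons A \<Gamma>)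
  show ?case
  proof (cases i)
    case 0
    then show ?thesis using Cons.prems by (auto intro: typing_start)
  next
    case (Suc j)
    then have "typing \<Gamma> (Var j) (((\<lambda>M. lift M 0) ^^ Suc j) (\<Gamma> ! j))" using Cons by auto
    from typing_weak[OF this typing_correct[OF this], of A] show ?thesis
      using Suc Cons.prems by simp
  qed
qed simp

lemma Pi1_sound:
  assumes abc: "(a, b, c) \<in> Rules X"
  shows "typing [] (lams [Cst a, Pi (Var 0) (Cst b)] (Pi (Var 1) (App (Var 1) (Var 0))))
    (pis [Cst a, Pi (Var 0) (Cst b)] (Cst c))"
proof -
  note s = rule_sorts[OF abc]
  have 1: "wf_ctx [Cst a]" by (simp add: is_type_Cst)
  have "typing [Cst a] (Var 0) (Cst a)" by (rule typing_Var[OF 1]) auto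
  then have "is_type [Cst a] (Var 0)" using s by (auto intro: is_typeI)
  then have 2: "wf_ctx [Pi (Var 0) (Cst b), Cst a]" using 1 by (auto intro!: is_type_Pi is_type_Cst)
  have u: "typing [Pi (Var 0) (Cst b), Cst a] (Var 1) (Cst a)" by (rule typing_Var[OF 2]) auto
  then have 3: "wf_ctx [Var 1, Pi (Var 0) (Cst b), Cst a]" using 2 s by (auto intro: is_typeI)
  have "typing [Var 1, Pi (Var 0) (Cst b), Cst a] (Var 1) (Pi (Var 2) (Cst b))"
    by (rule typing_Var[OF 3]) (auto simp: numeral_eq_Suc)
  moreover have "typing [Var 1, Pi (Var 0) (Cst b), Cst a] (Var 0) (Var 2)"
    by (rule typing_Var[OF 3]) (auto simp: numeral_eq_Suc)
  ultimately have "typing [Var 1, Pi (Var 0) (Cst b), Cst a] (App (Var 1) (Var 0)) (Cst b)"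
    by (rule typing_application) simp
  then show ?thesis using u abc by (auto intro!: typing_abstraction intro: typing.prod)
qed

lemma I1_sound:
  assumes "a \<in> Sorts X"
  shows "typing [] (lams [Cst a, Var 0] (Var 0)) (pis [Cst a, Var 0] (Var 1))"
proof -
  have 1: "wf_ctx [Cst a]" by (simp add: is_type_Cst)
  have "typing [Cst a] (Var 0) (Cst a)" by (rule typing_Var[OF 1]) auto
  then have 2: "wf_ctx [Var 0, Cst a]" using assms 1 by (auto intro: is_typeI)
  have "typing [Var 0, Cst a] (Var 0) (Var 1)" by (rule typing_Var[OF 2]) auto
  then show ?thesis by (auto intro!: typing_abstraction)
qed

lemma K1_sound:
  assumes "a \<in> Sorts X" "b \<in> Sorts X"
  shows "typing [] (lams [Cst a, Cst b, Var 1, Var 1] (Var 1))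
    (pis [Cst a, Cst b, Var 1, Var 1] (Var 3))"
proof -
  have 2: "wf_ctx [Cst b, Cst a]" by (simp add: is_type_Cst)
  have "typing [Cst b, Cst a] (Var 1) (Cst a)" by (rule typing_Var[OF 2]) auto
  then have 3: "wf_ctx [Var 1, Cst b, Cst a]" using assms 2 by (auto intro: is_typeI)
  have "typing [Var 1, Cst b, Cst a] (Var 1) (Cst b)" by (rule typing_Var[OF 3]) auto
  then have 4: "wf_ctx [Var 1, Var 1, Cst b, Cst a]" using assms 3 by (auto intro: is_typeI)
  have "typing [Var 1, Var 1, Cst b, Cst a] (Var 1) (Var 3)"
    by (rule typing_Var[OF 4]) (auto simp: numeral_eq_Suc)
  then show ?thesis by (auto intro!: typing_abstraction)
qed

definition S1_inst :: "'c \<Rightarrow> 'c \<Rightarrow> 'c \<Rightarrow> 'c trm list" where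
  "S1_inst a b c =
    [Cst a,
     Pi (Var 0) (Cst b),
     Pi (Var 1) (Pi (App (Var 1) (Var 0)) (Cst c)),
     Pi (Var 2) (Pi (App (Var 2) (Var 0)) (App (App (Var 2) (Var 1)) (Var 0))),
     Pi (Var 3) (App (Var 3) (Var 0)),
     Var 4]"

lemma S1_sound:
  assumes s: "a \<in> Sorts X" "b \<in> Sorts X" "c \<in> Sorts X"
  shows "typing [] (lams (S1_inst a b c) (App (App (Var 2) (Var 0)) (App (Var 1) (Var 0))))
    (pis (S1_inst a b c) (App (App (Var 3) (Var 0)) (App (Var 1) (Var 0))))"
proof -
  \<comment> \<open>\<open>\<Gamma>2\<close> to \<open>\<Gamma>6\<close> are the contexts of the
    first two to six of the bound variables \<open>u, v, t, w, z, x\<close>; each is shown well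
    formed by typing its new declaration in the previous one.\<close>
  define \<Gamma>2 where "\<Gamma>2 = [Pi (Var 0) (Cst b), Cst a]"
  define \<Gamma>3 where "\<Gamma>3 = Pi (Var 1) (Pi (App (Var 1) (Var 0)) (Cst c)) # \<Gamma>2"
  define \<Gamma>4 where
    "\<Gamma>4 = Pi (Var 2) (Pi (App (Var 2) (Var 0)) (App (App (Var 2) (Var 1)) (Var 0))) # \<Gamma>3"
  define \<Gamma>5 where "\<Gamma>5 = Pi (Var 3) (App (Var 3) (Var 0)) # \<Gamma>4"
  define \<Gamma>6 where "\<Gamma>6 = Var 4 # \<Gamma>5"
  note defs = \<Gamma>2_def \<Gamma>3_def \<Gamma>4_def \<Gamma>5_def \<Gamma>6_def
  have 1: "wf_ctx [Cst a]" by (simp add: is_type_Cst)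
  have "typing [Cst a] (Var 0) (Cst a)" by (rule typing_Var[OF 1]) auto
  then have "is_type [Cst a] (Var 0)" using s by (auto intro: is_typeI)
  then have 2: "wf_ctx \<Gamma>2" using 1 by (auto simp: \<Gamma>2_def intro!: is_type_Pi is_type_Cst)
  have "typing \<Gamma>2 (Var 1) (Cst a)" by (rule typing_Var[OF 2]) (auto simp: defs)
  then have u: "is_type \<Gamma>2 (Var 1)" using s by (auto intro: is_typeI)
  then have wf: "wf_ctx (Var 1 # \<Gamma>2)" using 2 by simp
  have "typing (Var 1 # \<Gamma>2) (Var 1) (Pi (Var 2) (Cst b))" "typing (Var 1 # \<Gamma>2) (Var 0) (Var 2)"
    by (rule typing_Var[OF wf]; auto simp: defs numeral_eq_Suc)+
  then have "typing (Var 1 # \<Gamma>2) (App (Var 1) (Var 0)) (Cst b)" by (rule typing_application) simp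
  then have "is_type (Var 1 # \<Gamma>2) (App (Var 1) (Var 0))" using s by (auto intro: is_typeI)
  then have 3: "wf_ctx \<Gamma>3" unfolding \<Gamma>3_def using 2 u wf by (auto intro!: is_type_Pi is_type_Cst)
  have "typing \<Gamma>3 (Var 2) (Cst a)"
    by (rule typing_Var[OF 3]) (auto simp: defs numeral_eq_Suc)
  then have u: "is_type \<Gamma>3 (Var 2)" using s by (auto intro: is_typeI)
  then have wf: "wf_ctx (Var 2 # \<Gamma>3)" using 3 by simp
  have "typing (Var 2 # \<Gamma>3) (Var 2) (Pi (Var 3) (Cst b))" "typing (Var 2 # \<Gamma>3) (Var 0) (Var 3)"
    by (rule typing_Var[OF wf]; auto simp: defs numeral_eq_Suc)+
  then have "typing (Var 2 # \<Gamma>3) (App (Var 2) (Var 0)) (Cst b)" by (rule typing_application) simp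
  then have vx: "is_type (Var 2 # \<Gamma>3) (App (Var 2) (Var 0))" using s by (auto intro: is_typeI)
  let ?\<Delta> = "App (Var 2) (Var 0) # Var 2 # \<Gamma>3"
  have wf: "wf_ctx ?\<Delta>" using vx wf by simp
  have "typing ?\<Delta> (Var 2) (Pi (Var 4) (Pi (App (Var 4) (Var 0)) (Cst c)))"
    "typing ?\<Delta> (Var 1) (Var 4)"
    by (rule typing_Var[OF wf]; auto simp: defs numeral_eq_Suc)+
  then have "typing ?\<Delta> (App (Var 2) (Var 1)) (Pi (App (Var 3) (Var 1)) (Cst c))"
    by (rule typing_application) simp
  moreover have "typing ?\<Delta> (Var 0) (App (Var 3) (Var 1))"
    by (rule typing_Var[OF wf]; auto simp: defs numeral_eq_Suc)
  ultimately have "typing ?\<Delta> (App (App (Var 2) (Var 1)) (Var 0)) (Cst c)"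
    by (rule typing_application) simp
  then have "is_type ?\<Delta> (App (App (Var 2) (Var 1)) (Var 0))" using s by (auto intro: is_typeI)
  then have 4: "wf_ctx \<Gamma>4" unfolding \<Gamma>4_def using 3 u vx by (auto intro!: is_type_Pi)
  have "typing \<Gamma>4 (Var 3) (Cst a)"
    by (rule typing_Var[OF 4]) (auto simp: defs numeral_eq_Suc)
  then have u: "is_type \<Gamma>4 (Var 3)" using s by (auto intro: is_typeI)
  then have wf: "wf_ctx (Var 3 # \<Gamma>4)" using 4 by simp
  have "typing (Var 3 # \<Gamma>4) (Var 3) (Pi (Var 4) (Cst b))" "typing (Var 3 # \<Gamma>4) (Var 0) (Var 4)"
    by (rule typing_Var[OF wf]; auto simp: defs numeral_eq_Suc)+
  then have "typing (Var 3 # \<Gamma>4) (App (Var 3) (Var 0)) (Cst b)" by (rule typing_application) simp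
  then have "is_type (Var 3 # \<Gamma>4) (App (Var 3) (Var 0))" using s by (auto intro: is_typeI)
  then have 5: "wf_ctx \<Gamma>5" unfolding \<Gamma>5_def using 4 u by (auto intro!: is_type_Pi)
  have "typing \<Gamma>5 (Var 4) (Cst a)"
    by (rule typing_Var[OF 5]) (auto simp: defs numeral_eq_Suc)
  then have 6: "wf_ctx \<Gamma>6" unfolding \<Gamma>6_def using 5 s by (auto intro: is_typeI)
  have w: "typing \<Gamma>6 (Var 2) (Pi (Var 5)
      (Pi (App (Var 5) (Var 0)) (App (App (Var 5) (Var 1)) (Var 0))))"
    and z: "typing \<Gamma>6 (Var 1) (Pi (Var 5) (App (Var 5) (Var 0)))"
    and x: "typing \<Gamma>6 (Var 0) (Var 5)"
    by (rule typing_Var[OF 6]; auto simp: defs numeral_eq_Suc)+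
  have "typing \<Gamma>6 (App (Var 2) (Var 0))
      (Pi (App (Var 4) (Var 0)) (App (App (Var 4) (Var 1)) (Var 0)))"
    using w x by (rule typing_application) simp
  moreover have "typing \<Gamma>6 (App (Var 1) (Var 0)) (App (Var 4) (Var 0))"
    using z x by (rule typing_application) simp
  ultimately have "typing \<Gamma>6 (App (App (Var 2) (Var 0)) (App (Var 1) (Var 0)))
      (App (App (Var 3) (Var 0)) (App (Var 1) (Var 0)))"
    by (rule typing_application) simp
  then show ?thesis unfolding defs by (auto simp: S1_inst_def intro!: typing_abstraction)
qed

lemma map_S1_args: "map (map_trm \<rho>) S1_args = S1_inst (\<rho> 1) (\<rho> 2) (\<rho> 3)"
  by (simp add: S1_args_def S1_inst_def)

lemma map_lams: "map_trm f (lams As M) = lams (map (map_trm f) As) (map_trm f M)"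
  and map_pis: "map_trm f (pis As M) = pis (map (map_trm f) As) (map_trm f M)"
  by (induction As) auto

lemma scheme_sound:
  assumes "(P, M, A) \<in> hilbert_schemes X" "range \<rho> \<subseteq> Sorts X" "P \<rho>"
  shows "typing [] (map_trm \<rho> M) (map_trm \<rho> A)"
  using assms(1,3)
proof (induction rule: hilbert_schemes.induct)
  case Pi1
  then show ?case using Pi1_sound[of "\<rho> 1" "\<rho> 2" "\<rho> 3"] by simp
next
  case I1
  then show ?case using assms(2) I1_sound[of "\<rho> 1"] by (simp add: image_subset_iff)
next
  case K1
  then show ?case using assms(2) K1_sound[of "\<rho> 1" "\<rho> 2"] by (simp add: image_subset_iff)
next
  case S1
  then show ?case using assms(2) S1_sound[of "\<rho> 1" "\<rho> 2" "\<rho> 3"]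
    by (simp add: map_lams map_pis map_S1_args image_subset_iff)
\<comment> \<open>The schemes from (I) and (II) carry the derivability of their instances in the
  side condition.\<close>
qed (simp_all add: typing_iff_pts_typing)

abbreviation hilbert :: "'c trm \<Rightarrow> 'c trm \<Rightarrow> bool" where
  "hilbert \<equiv> hpts_theorem (corresponding_hpts X)"

lemma hilbert_sound: "hilbert M A \<Longrightarrow> typing [] M A"
proof (induction rule: hpts_theorem.induct)
  case (ax c s)
  then show ?case by (auto simp: corresponding_hpts_def intro: typing.ax)
next
  case (scheme P M A \<rho>)
  then show ?case by (auto simp: corresponding_hpts_def intro: scheme_sound)
next
  case (application M A B N)
  then show ?case by (auto intro: typing_application)
next
  case (conversion M A B s)
  then show ?case by (auto simp: corresponding_hpts_def intro: typing.conv)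
next
  case (type_reduction M A B)
  then show ?case by (auto intro: typing_type_reduction)
next
  case (subject_reduction M A N)
  then show ?case by (auto intro: supersorted_pts.subject_reduction[OF supersorted_pts_axioms])
qed

end

subsection \<open>Types of the axiom schemes\<close>

text \<open>Rule (I) gives a sort to the type \<open>T\<close> of a scheme, and each use of rule
  (II) turns one more leading product into an abstraction: after \<open>i\<close> uses the statement
  is \<open>lam_prefix i T : pi_prefix i T s\<close>.\<close>

fun lam_prefix :: "nat \<Rightarrow> 'c trm \<Rightarrow> 'c trm" where
  "lam_prefix (Suc n) (Pi A B) = Lam A (lam_prefix n B)"
| "lam_prefix n T = T"

fun pi_prefix :: "nat \<Rightarrow> 'c trm \<Rightarrow> 'c \<Rightarrow> 'c trm" where
  "pi_prefix (Suc n) (Pi A B) c = Pi A (pi_prefix n B c)"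
| "pi_prefix n T c = Cst c"

text \<open>Guards against the catch-all clauses of the prefix functions, where substitution or
  reduction could expose a product and change the prefix.\<close>

fun has_pis :: "nat \<Rightarrow> 'c trm \<Rightarrow> bool" where
  "has_pis 0 T = True"
| "has_pis (Suc n) (Pi A B) = has_pis n B"
| "has_pis (Suc n) T = False"

lemma pi_prefix_0 [simp]: "pi_prefix 0 T c = Cst c"
  by (cases T) simp_all

lemma has_pis_mono: "has_pis n T \<Longrightarrow> i \<le> n \<Longrightarrow> has_pis i T"
proof (induction n T arbitrary: i rule: has_pis.induct)
  case (2 n A B)
  then show ?case by (cases i) auto
qed auto

lemma has_pis_pi_prefix: "has_pis n T \<Longrightarrow> i \<le> n \<Longrightarrow> has_pis i (pi_prefix n T c)"
proof (induction n T arbitrary: i rule: has_pis.induct)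
  case (2 n A B)
  then show ?case by (cases i) auto
qed auto

lemma pi_prefix_pi_prefix:
  "has_pis n T \<Longrightarrow> i \<le> n \<Longrightarrow> pi_prefix i (pi_prefix n T c) d = pi_prefix i T d"
proof (induction n T arbitrary: i rule: has_pis.induct)
  case (2 n A B)
  then show ?case by (cases i) auto
qed auto

lemma map_lam_prefix: "map_trm f (lam_prefix n T) = lam_prefix n (map_trm f T)"
  by (induction n T rule: lam_prefix.induct) auto

lemma map_pi_prefix: "map_trm f (pi_prefix n T c) = pi_prefix n (map_trm f T) (f c)"
  by (induction n T c rule: pi_prefix.induct) auto

lemma has_pis_map: "has_pis n (map_trm f T) = has_pis n T"
  by (induction n T rule: has_pis.induct) auto

lemma set_pi_prefix: "set_trm (pi_prefix n T c) \<subseteq> insert c (set_trm T)"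
  by (induction n T c rule: pi_prefix.induct) auto

text \<open>Brings two consecutive prefixes into the shape to which \<open>gen_II\<close>
  applies.\<close>

lemma prefix_lams:
  "has_pis (Suc i) T \<Longrightarrow> \<exists>As A B. lam_prefix i T = lams As (Pi A B) \<and>
    lam_prefix (Suc i) T = lams (As @ [A]) B \<and>
    (\<forall>c. pi_prefix i T c = pis As (Cst c)) \<and> (\<forall>c. pi_prefix (Suc i) T c = pis (As @ [A]) (Cst c))"
proof (induction i arbitrary: T)
  case 0
  then obtain A B where "T = Pi A B" by (cases T) auto
  then show ?case by (intro exI[of _ "[]"] exI[of _ A] exI[of _ B]) auto
next
  case (Suc i)
  then obtain C T' where T: "T = Pi C T'" "has_pis (Suc i) T'" by (cases T) auto
  from Suc.IH[OF T(2)] obtain As A B where "lam_prefix i T' = lams As (Pi A B)"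
    "lam_prefix (Suc i) T' = lams (As @ [A]) B"
    "\<forall>c. pi_prefix i T' c = pis As (Cst c)" "\<forall>c. pi_prefix (Suc i) T' c = pis (As @ [A]) (Cst c)"
    by blast
  then show ?case using T by (intro exI[of _ "C # As"] exI[of _ A] exI[of _ B]) auto
qed

lemma prefix_subst:
  "has_pis n T \<Longrightarrow> lam_prefix n (subst T N k) = subst (lam_prefix n T) N k"
  "has_pis n T \<Longrightarrow> pi_prefix n (subst T N k) c = subst (pi_prefix n T c) N k"
  "has_pis n T \<Longrightarrow> has_pis n (subst T N k)"
  by (induction n T arbitrary: N k rule: has_pis.induct) auto

lemma prefix_betas:
  "has_pis n T \<Longrightarrow> beta\<^sup>*\<^sup>* T T' \<Longrightarrow> has_pis n T' \<and> beta\<^sup>*\<^sup>* (lam_prefix n T) (lam_prefix n T') \<and>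
    beta\<^sup>*\<^sup>* (pi_prefix n T c) (pi_prefix n T' c)"
proof (induction n T arbitrary: T' rule: has_pis.induct)
  case (2 n A B)
  then show ?case by (auto dest!: betas_Pi intro!: beta_rtranclp_cong)
qed auto

context supersorted_pts
begin

lemma typing_lam_prefix:
  "is_type \<Gamma> T \<Longrightarrow> has_pis n T \<Longrightarrow> \<exists>s\<in>Sorts X. typing \<Gamma> (lam_prefix n T) (pi_prefix n T s)"
proof (induction n T arbitrary: \<Gamma> rule: has_pis.induct)
  case (2 n A B)
  then have "is_type (A # \<Gamma>) B" by (meson gen_Pi is_type_def)
  with 2 show ?case by (auto dest: typing_abstraction)
qed (auto simp: is_type_def)

lemma is_type_pi_prefix: "is_type \<Gamma> T \<Longrightarrow> has_pis n T \<Longrightarrow> is_type \<Gamma> (pi_prefix n T s)"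
  by (induction n T arbitrary: \<Gamma> rule: has_pis.induct)
    (auto simp: is_type_def dest: typing_wf_ctx intro: is_type_Cst[unfolded is_type_def],
      metis gen_Pi is_type_Pi is_type_def)

text \<open>\<open>t i\<close> is the variable for the sort in the prefix of length
  \<open>i\<close>. Rule (I) discards \<open>P\<close> and rule (II) only adds derivability
  conditions, so typability of the prefixes up to \<open>i\<close> implies the new side
  condition.\<close>

lemma scheme_lam_prefix:
  assumes "(P, M, T) \<in> hilbert_schemes X" "has_pis n T" "0 < n" "i \<le> n"
  shows "\<exists>Q. (Q, lam_prefix i T, pi_prefix i T (t i)) \<in> hilbert_schemes X \<and>
    (\<forall>\<rho>. (\<forall>j\<le>i. typing [] (map_trm \<rho> (lam_prefix j T)) (map_trm \<rho> (pi_prefix j T (t j)))) \<longrightarrow> Q \<rho>)"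
  using assms(4)
proof (induction i)
  case 0
  \<comment> \<open>\<open>T\<close> starts with a product since \<open>n\<close> is positive, so
    (I) applies, with \<open>A' = T\<close> by reflexivity.\<close>
  have "\<forall>i. T \<noteq> Cst i" using assms(2,3) by (cases n) auto
  from hilbert_schemes.gen_I[OF assms(1) this, of T "t 0"] show ?case
    by (auto simp: typing_iff_pts_typing)
next
  case (Suc i)
  then obtain Q where Q: "(Q, lam_prefix i T, pi_prefix i T (t i)) \<in> hilbert_schemes X"
    "\<And>\<rho>. (\<forall>j\<le>i. typing [] (map_trm \<rho> (lam_prefix j T)) (map_trm \<rho> (pi_prefix j T (t j)))) \<Longrightarrow> Q \<rho>"
    by auto
  from Suc.prems obtain As A B where eq: "lam_prefix i T = lams As (Pi A B)"
    "lam_prefix (Suc i) T = lams (As @ [A]) B" "\<And>c. pi_prefix i T c = pis As (Cst c)"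
    "\<And>c. pi_prefix (Suc i) T c = pis (As @ [A]) (Cst c)"
    using prefix_lams[OF has_pis_mono[OF assms(2) Suc.prems]] by blast
  from Q(1) have "(Q, lams As (Pi A B), pis As (Cst (t i))) \<in> hilbert_schemes X"
    unfolding eq .
  from hilbert_schemes.gen_II[OF this, of "t (Suc i)"] show ?case
    unfolding eq(2)[symmetric] eq(4)[symmetric] using Q(2)
    by (blast intro: le_SucI dest: typing_iff_pts_typing[THEN iffD1])
qed

lemma hilbert_axiom: "(c, s) \<in> Axioms X \<Longrightarrow> hilbert (Cst c) (Cst s)"
  by (rule hpts_theorem.ax) (simp add: corresponding_hpts_def)

lemma hilbert_scheme:
  "(P, M, A) \<in> hilbert_schemes X \<Longrightarrow> range \<rho> \<subseteq> Sorts X \<Longrightarrow> P \<rho> \<Longrightarrow> hilbert (map_trm \<rho> M) (map_trm \<rho> A)"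
  by (rule hpts_theorem.scheme[where P = P]) (auto simp: corresponding_hpts_def)

lemma hilbert_lam_prefix:
  assumes sch: "(P, M, T) \<in> hilbert_schemes X" and n: "has_pis n T" "0 < n" "i \<le> n"
    and \<rho>: "range \<rho> \<subseteq> Sorts X" and fresh: "set_trm T \<subseteq> {..<m}"
    and T: "is_type [] (map_trm \<rho> T)"
  shows "\<exists>s\<in>Sorts X. hilbert (lam_prefix i (map_trm \<rho> T)) (pi_prefix i (map_trm \<rho> T) s)"
proof -
  \<comment> \<open>Quantified over every \<open>j\<close> so that \<sigma> is total with values in
    \<open>Sorts X\<close>, as the assignment \<open>\<rho>'\<close> has to be.\<close>
  have "\<exists>s\<in>Sorts X. j \<le> n \<longrightarrow> typing [] (lam_prefix j (map_trm \<rho> T)) (pi_prefix j (map_trm \<rho> T) s)" for j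
    using typing_lam_prefix[OF T, of j] n(1) \<rho>
      by (cases "j \<le> n") (auto simp: has_pis_map has_pis_mono)
  then obtain \<sigma> where \<sigma>: "\<And>j. \<sigma> j \<in> Sorts X"
    "\<And>j. j \<le> n \<Longrightarrow> typing [] (lam_prefix j (map_trm \<rho> T)) (pi_prefix j (map_trm \<rho> T) (\<sigma> j))"
    by metis
  \<comment> \<open>The sort variables of \<open>T\<close> are below \<open>m\<close>;
    \<open>m + j\<close> is a fresh one for the sort in the prefix of length \<open>j\<close>, so
    these sorts can be chosen independently.\<close>
  define \<rho>' where "\<rho>' = (\<lambda>k. if k < m then \<rho> k else \<sigma> (k - m))"
  have T': "map_trm \<rho>' T = map_trm \<rho> T" using fresh by (auto simp: \<rho>'_def intro!: trm.map_cong0)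
  have \<sigma>': "\<rho>' (m + j) = \<sigma> j" for j by (simp add: \<rho>'_def)
  have range: "range \<rho>' \<subseteq> Sorts X" using \<rho> \<sigma>(1) by (auto simp: \<rho>'_def)
  obtain Q where Q: "(Q, lam_prefix i T, pi_prefix i T (m + i)) \<in> hilbert_schemes X"
    "(\<forall>j\<le>i. typing [] (map_trm \<rho>' (lam_prefix j T)) (map_trm \<rho>' (pi_prefix j T (m + j)))) \<Longrightarrow> Q \<rho>'"
    using scheme_lam_prefix[OF sch n, of "\<lambda>j. m + j"] by auto
  have "Q \<rho>'" using Q(2) \<sigma>(2) n(3) by (simp add: map_lam_prefix map_pi_prefix T' \<sigma>')
  from hilbert_scheme[OF Q(1) range this] show ?thesis
    using \<sigma>(1)[of i] by (auto simp: map_lam_prefix map_pi_prefix T' \<sigma>')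
qed

text \<open>A second round: (I) and (II) produce a scheme of type \<open>pi_prefix j T m\<close>,
  and \<open>hilbert_lam_prefix\<close> then applies to that scheme.\<close>

lemma hilbert_lam_pi_prefix:
  assumes sch: "(P, M, T) \<in> hilbert_schemes X" and n: "has_pis n T" "j \<le> n" "i \<le> j"
    and \<rho>: "range \<rho> \<subseteq> Sorts X" and fresh: "set_trm T \<subseteq> {..<m}"
    and T: "is_type [] (map_trm \<rho> T)" and s: "s \<in> Sorts X"
  shows "\<exists>s'\<in>Sorts X. hilbert (lam_prefix i (pi_prefix j (map_trm \<rho> T) s))
    (pi_prefix i (pi_prefix j (map_trm \<rho> T) s) s')"
proof (cases "j = 0")
  \<comment> \<open>Here the type is a sort, to which (I) does not apply; an axiom types it.\<close>
  case True
  then show ?thesis using n(3) ex_axiom[of s]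
    by (auto intro: hilbert_axiom)
next
  case False
  define \<rho>' where "\<rho>' = \<rho>(m := s)"
  have T': "map_trm \<rho>' T = map_trm \<rho> T" using fresh by (auto simp: \<rho>'_def intro!: trm.map_cong0)
  have eq: "map_trm \<rho>' (pi_prefix j T m) = pi_prefix j (map_trm \<rho> T) s"
    by (simp add: map_pi_prefix T') (simp add: \<rho>'_def)
  \<comment> \<open>The next round starts with (I), which discards the side condition
    \<open>Q\<close>; hence a single variable \<open>m\<close> can stand for all the sorts
    introduced here.\<close>
  obtain Q where Q: "(Q, lam_prefix j T, pi_prefix j T m) \<in> hilbert_schemes X"
    using scheme_lam_prefix[OF sch n(1) _ n(2), of "\<lambda>_. m"] False n(2) by auto
  have pis: "has_pis j T" using n has_pis_mono by blast
  have ty: "is_type [] (map_trm \<rho>' (pi_prefix j T m))"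
    unfolding eq using T pis by (auto intro: is_type_pi_prefix simp: has_pis_map)
  have "set_trm (pi_prefix j T m) \<subseteq> {..<Suc m}"
    using set_pi_prefix[of j T m] fresh by force
  from hilbert_lam_prefix[OF Q has_pis_pi_prefix[OF pis order.refl] _ n(3) _ this ty] False \<rho> s
  show ?thesis unfolding eq by (auto simp: \<rho>'_def)
qed

subsection \<open>Hilbert-style derivability in context\<close>

lemma typing_closed: "typing \<Gamma> M A \<Longrightarrow> length \<Gamma> \<le> k \<Longrightarrow> lift M k = M"
proof (induction arbitrary: k rule: typing.induct)
  case (weak \<Gamma> M B b A a)
  then show ?case by (cases k) (auto simp: lift_lift_Suc)
qed auto

definition derivable :: "'c trm list \<Rightarrow> 'c trm \<Rightarrow> 'c trm \<Rightarrow> bool" where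
  "derivable \<Gamma> M A \<longleftrightarrow> hilbert (lams (rev \<Gamma>) M) (pis (rev \<Gamma>) A)"

definition has_sort :: "'c trm list \<Rightarrow> 'c trm \<Rightarrow> bool" where
  "has_sort \<Gamma> A \<longleftrightarrow> (\<exists>s\<in>Sorts X. derivable \<Gamma> A (Cst s))"

lemma derivable_Nil: "derivable [] M A \<longleftrightarrow> hilbert M A"
  by (simp add: derivable_def)

lemma derivable_Cons: "derivable (C # \<Gamma>) M A \<longleftrightarrow> derivable \<Gamma> (Lam C M) (Pi C A)"
  by (simp add: derivable_def)

lemma has_sort_Cons: "has_sort (C # \<Gamma>) A \<longleftrightarrow> (\<exists>s\<in>Sorts X. derivable \<Gamma> (Lam C A) (Pi C (Cst s)))"
  by (simp add: has_sort_def derivable_Cons)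

lemma has_sortI: "derivable \<Gamma> A (Cst s) \<Longrightarrow> s \<in> Sorts X \<Longrightarrow> has_sort \<Gamma> A"
  by (auto simp: has_sort_def)

lemma derivable_beta: "derivable \<Gamma> M A \<Longrightarrow> beta M N \<Longrightarrow> derivable \<Gamma> N A"
  unfolding derivable_def by (rule hpts_theorem.subject_reduction) (auto intro: beta_lams)

lemma derivable_betas:
  assumes "derivable \<Gamma> M A" "beta\<^sup>*\<^sup>* M N" "beta\<^sup>*\<^sup>* A B"
  shows "derivable \<Gamma> N B"
proof -
  have "derivable \<Gamma> N A" using assms(2,1) by induction (auto intro: derivable_beta)
  with assms(3) show ?thesis
  proof induction
    case (step B C)
    then show ?case unfolding derivable_def
      by (blast intro: hpts_theorem.type_reduction beta_pis)
  qed
qed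

text \<open>The sort premises are what S1 demands when closure is passed to a longer context;
  \<open>typing.app\<close> carries the same premises.\<close>

definition app_closed :: "'c trm list \<Rightarrow> bool" where
  "app_closed \<Gamma> \<longleftrightarrow> (\<forall>M N A B. derivable \<Gamma> M (Pi A B) \<longrightarrow> derivable \<Gamma> N A \<longrightarrow> has_sort \<Gamma> A \<longrightarrow>
     has_sort (A # \<Gamma>) B \<longrightarrow> derivable \<Gamma> (App M N) (subst B N 0))"

text \<open>A sort for \<open>A\<close> is assumed because K1, which weakens theorems, takes the
  type as an argument.\<close>

definition contains_theorems :: "'c trm list \<Rightarrow> bool" where
  "contains_theorems \<Gamma> \<longleftrightarrow> (\<forall>M A. derivable [] M A \<longrightarrow> has_sort [] A \<longrightarrow> derivable \<Gamma> M A)"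

text \<open>
  \<open>tails \<Gamma> n T\<close> is what rules (I) and (II) provide for the type \<open>T\<close> of a scheme. Applying a
  function of type \<open>T\<close> to several arguments also requires the types \<open>pi_prefix j T s\<close> of these
  tails to have tails; \<open>saturated\<close> is closed under this step, under instantiation of the outermost
  product and under reduction.
\<close>

definition tails :: "'c trm list \<Rightarrow> nat \<Rightarrow> 'c trm \<Rightarrow> bool" where
  "tails \<Gamma> n T \<longleftrightarrow> (\<forall>i\<le>n. \<exists>s\<in>Sorts X. derivable \<Gamma> (lam_prefix i T) (pi_prefix i T s))"

definition saturated :: "'c trm list \<Rightarrow> nat \<Rightarrow> 'c trm \<Rightarrow> bool" where
  "saturated \<Gamma> n T \<longleftrightarrow>
     has_pis n T \<and> tails \<Gamma> n T \<and> (\<forall>j\<le>n. \<forall>s\<in>Sorts X. tails \<Gamma> j (pi_prefix j T s))"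

lemma tailsD: "tails \<Gamma> n T \<Longrightarrow> i \<le> n \<Longrightarrow> \<exists>s\<in>Sorts X. derivable \<Gamma> (lam_prefix i T) (pi_prefix i T s)"
  by (simp add: tails_def)

lemma scheme_saturated:
  assumes "(P, M, T) \<in> hilbert_schemes X" "has_pis n T" "0 < n"
    and "range \<rho> \<subseteq> Sorts X" "set_trm T \<subseteq> {..<m}" "P \<rho>"
  shows "saturated [] n (map_trm \<rho> T)"
proof -
  have T: "is_type [] (map_trm \<rho> T)" using scheme_sound[OF assms(1,4,6)] typing_correct by blast
  show ?thesis
    using assms hilbert_lam_prefix[OF assms(1,2,3) _ assms(4,5) T]
      hilbert_lam_pi_prefix[OF assms(1,2) _ _ assms(4,5) T]
    by (simp add: saturated_def tails_def derivable_Nil has_pis_map)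
qed

lemma tails_betas: "has_pis n T \<Longrightarrow> tails \<Gamma> n T \<Longrightarrow> beta\<^sup>*\<^sup>* T T' \<Longrightarrow> tails \<Gamma> n T'"
  unfolding tails_def by (meson derivable_betas has_pis_mono prefix_betas)

lemma saturated_betas:
  assumes "saturated \<Gamma> n T" "beta\<^sup>*\<^sup>* T T'"
  shows "saturated \<Gamma> n T'"
proof -
  have pis: "has_pis j T" if "j \<le> n" for j
    using assms(1) that has_pis_mono by (auto simp: saturated_def)
  have "tails \<Gamma> j (pi_prefix j T' s)" if j: "j \<le> n" and s: "s \<in> Sorts X" for j s
  proof (rule tails_betas)
    show "has_pis j (pi_prefix j T s)" using pis[OF j] by (rule has_pis_pi_prefix) simp
    show "tails \<Gamma> j (pi_prefix j T s)" using assms(1) j s by (simp add: saturated_def)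
    show "beta\<^sup>*\<^sup>* (pi_prefix j T s) (pi_prefix j T' s)"
      using prefix_betas[OF pis[OF j] assms(2)] by simp
  qed
  moreover have "tails \<Gamma> n T'"
    using tails_betas[OF pis _ assms(2)] assms(1) by (simp add: saturated_def)
  moreover have "has_pis n T'" using prefix_betas[OF pis assms(2), of n] by simp
  ultimately show ?thesis by (simp add: saturated_def)
qed

text \<open>The prefix of \<open>Pi A B\<close> of length \<open>i + 1\<close>, applied to
  \<open>N\<close> and contracted, is the prefix of \<open>subst B N 0\<close> of length
  \<open>i\<close>. The premise \<open>sorts\<close> gives a sort to the codomain in that
  application.\<close>

lemma tails_app:
  assumes app: "app_closed \<Gamma>" and pis: "has_pis n B" and tails: "tails \<Gamma> (Suc n) (Pi A B)"
    and sorts: "\<And>i s. i \<le> n \<Longrightarrow> s \<in> Sorts X \<Longrightarrow> has_sort (A # \<Gamma>) (pi_prefix i B s)"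
    and N: "derivable \<Gamma> N A" "has_sort \<Gamma> A"
  shows "tails \<Gamma> n (subst B N 0)"
  unfolding tails_def
proof (intro allI impI)
  fix i assume i: "i \<le> n"
  then obtain s where s: "s \<in> Sorts X" "derivable \<Gamma> (Lam A (lam_prefix i B))
      (Pi A (pi_prefix i B s))"
    using tailsD[OF tails, of "Suc i"] by auto
  have "derivable \<Gamma> (App (Lam A (lam_prefix i B)) N) (subst (pi_prefix i B s) N 0)"
    using app s N sorts[OF i s(1)] by (auto simp: app_closed_def)
  then have "derivable \<Gamma> (subst (lam_prefix i B) N 0) (subst (pi_prefix i B s) N 0)"
    by (rule derivable_beta) (rule beta.beta)
  then show "\<exists>s\<in>Sorts X. derivable \<Gamma> (lam_prefix i (subst B N 0)) (pi_prefix i (subst B N 0) s)"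
    using s(1) has_pis_mono[OF pis i] by (auto simp: prefix_subst)
qed

lemma saturated_pi_prefix:
  "saturated \<Gamma> n T \<Longrightarrow> j \<le> n \<Longrightarrow> s \<in> Sorts X \<Longrightarrow> saturated \<Gamma> j (pi_prefix j T s)"
  using has_pis_mono[of n T j] by (auto simp: saturated_def has_pis_pi_prefix pi_prefix_pi_prefix)

lemma saturated_sort: "saturated \<Gamma> (Suc n) (Pi A B) \<Longrightarrow> has_sort (A # \<Gamma>) B"
  using tailsD[of \<Gamma> "Suc n" "Pi A B" 1] by (auto simp: saturated_def has_sort_Cons)

lemma saturated_app:
  assumes app: "app_closed \<Gamma>" and sat: "saturated \<Gamma> (Suc n) (Pi A B)"
    and N: "derivable \<Gamma> N A" "has_sort \<Gamma> A"
  shows "saturated \<Gamma> n (subst B N 0)"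
proof -
  have pis: "has_pis n B" using sat by (simp add: saturated_def)
  have sorts: "has_sort (A # \<Gamma>) (pi_prefix i B s)" if "i \<le> n" "s \<in> Sorts X" for i s
  proof -
    \<comment> \<open>The prefix of length one of this type abstracts \<open>pi_prefix i B s\<close>
      over \<open>A\<close> and types it by a sort; this is the purpose of the last conjunct of
      \<open>saturated\<close>.\<close>
    have "tails \<Gamma> (Suc i) (pi_prefix (Suc i) (Pi A B) s)"
      using sat that by (auto simp: saturated_def)
    from tailsD[OF this, of 1] show ?thesis by (auto simp: has_sort_Cons)
  qed
  have "tails \<Gamma> j (pi_prefix j (subst B N 0) s)" if j: "j \<le> n" and s: "s \<in> Sorts X" for j s
  proof -
    have pj: "has_pis j B" using pis j by (rule has_pis_mono)
    have "tails \<Gamma> (Suc j) (pi_prefix (Suc j) (Pi A B) s)"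
      using sat j s by (auto simp: saturated_def simp del: pi_prefix.simps)
    then have "tails \<Gamma> j (subst (pi_prefix j B s) N 0)"
      using j sorts N pj
      by (intro tails_app[OF app]) (auto simp: has_pis_pi_prefix pi_prefix_pi_prefix)
    then show ?thesis using pj by (simp add: prefix_subst)
  qed
  moreover have "tails \<Gamma> n (subst B N 0)"
    using sat sorts N pis by (intro tails_app[OF app]) (auto simp: saturated_def)
  ultimately show ?thesis using pis by (simp add: saturated_def prefix_subst)
qed

lemma derivable_app:
  assumes "app_closed \<Gamma>" "derivable \<Gamma> (Lam A' L) (Pi A B)" "derivable \<Gamma> N A"
    and "has_sort \<Gamma> A" "has_sort (A # \<Gamma>) B"
  shows "derivable \<Gamma> (subst L N 0) (subst B N 0)"
proof -
  have "derivable \<Gamma> (App (Lam A' L) N) (subst B N 0)" using assms unfolding app_closed_def by blast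
  then show ?thesis by (rule derivable_beta) (rule beta.beta)
qed

lemma tails_contains:
  assumes "contains_theorems \<Gamma>" "tails [] n T"
    and sort: "\<And>i s. i \<le> n \<Longrightarrow> s \<in> Sorts X \<Longrightarrow> has_sort [] (pi_prefix i T s)"
  shows "tails \<Gamma> n T"
  unfolding tails_def
proof (intro allI impI)
  fix i assume i: "i \<le> n"
  from tailsD[OF assms(2) i] obtain s where s: "s \<in> Sorts X"
    "derivable [] (lam_prefix i T) (pi_prefix i T s)" by blast
  then have "derivable \<Gamma> (lam_prefix i T) (pi_prefix i T s)"
    using assms(1) sort[OF i s(1)] unfolding contains_theorems_def by blast
  with s(1) show "\<exists>s\<in>Sorts X. derivable \<Gamma> (lam_prefix i T) (pi_prefix i T s)" by blast
qed

lemma saturated_contains: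
  assumes "contains_theorems \<Gamma>" "saturated [] n T"
  shows "saturated \<Gamma> n T"
proof -
  have pis: "has_pis j T" if "j \<le> n" for j
    using assms(2) that has_pis_mono by (auto simp: saturated_def)
  have tails: "tails [] j (pi_prefix j T s)" if "j \<le> n" "s \<in> Sorts X" for j s
    using assms(2) that by (simp add: saturated_def)
  have sort: "has_sort [] (pi_prefix j T s)" if "j \<le> n" "s \<in> Sorts X" for j s
    using tailsD[OF tails[OF that], of 0] by (simp add: has_sort_def)
  have "tails [] n T" using assms(2) by (simp add: saturated_def)
  from tails_contains[OF assms(1) this] have "tails \<Gamma> n T" using sort by blast
  moreover have "tails \<Gamma> j (pi_prefix j T s)" if "j \<le> n" "s \<in> Sorts X" for j s
    by (rule tails_contains[OF assms(1) tails[OF that]])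
      (use sort that in \<open>simp add: pi_prefix_pi_prefix[OF pis]\<close>)
  ultimately show ?thesis using pis by (simp add: saturated_def)
qed

section \<open>The combinators and their saturated types\<close>

lemma sort_valuation:
  assumes "a \<in> Sorts X" "b \<in> Sorts X" "c \<in> Sorts X"
  obtains \<rho> :: "nat \<Rightarrow> 'c" where "range \<rho> \<subseteq> Sorts X" "\<rho> (Suc 0) = a" "\<rho> 2 = b" "\<rho> 3 = c"
  using that[of "\<lambda>i. if i = 1 then a else if i = 2 then b else c"] assms by auto

lemma Pi1_derivable:
  assumes "(a, b, c) \<in> Rules X"
  shows "derivable [] (Lam (Cst a) (Lam (Pi (Var 0) (Cst b)) (Pi (Var 1) (App (Var 1) (Var 0)))))
      (Pi (Cst a) (Pi (Pi (Var 0) (Cst b)) (Cst c)))"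
    and "saturated [] 2 (Pi (Cst a) (Pi (Pi (Var 0) (Cst b)) (Cst c)))"
proof -
  obtain \<rho> :: "nat \<Rightarrow> 'c" where \<rho>: "range \<rho> \<subseteq> Sorts X" "\<rho> (Suc 0) = a" "\<rho> 2 = b" "\<rho> 3 = c"
    using sort_valuation rule_sorts[OF assms] by metis
  note sch = hilbert_schemes.Pi1[of X]
  show "derivable [] (Lam (Cst a) (Lam (Pi (Var 0) (Cst b)) (Pi (Var 1) (App (Var 1) (Var 0)))))
      (Pi (Cst a) (Pi (Pi (Var 0) (Cst b)) (Cst c)))"
    using hilbert_scheme[OF sch \<rho>(1)] \<rho> assms by (simp add: derivable_Nil)
  \<comment> \<open>2 counts the leading products of the type, and 4 bounds its sort variables 1, 2,
    3; the same bound serves the other combinators.\<close>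
  show "saturated [] 2 (Pi (Cst a) (Pi (Pi (Var 0) (Cst b)) (Cst c)))"
    using scheme_saturated[OF sch _ _ \<rho>(1), of 2 4] \<rho> assms by (simp add: numeral_2_eq_2)
qed

lemma I1_derivable:
  assumes "a \<in> Sorts X"
  shows "derivable [] (Lam (Cst a) (Lam (Var 0) (Var 0))) (Pi (Cst a) (Pi (Var 0) (Var 1)))"
    and "saturated [] 2 (Pi (Cst a) (Pi (Var 0) (Var 1)))"
proof -
  obtain \<rho> :: "nat \<Rightarrow> 'c" where \<rho>: "range \<rho> \<subseteq> Sorts X" "\<rho> (Suc 0) = a"
    using sort_valuation assms by metis
  note sch = hilbert_schemes.I1[of X]
  show "derivable [] (Lam (Cst a) (Lam (Var 0) (Var 0))) (Pi (Cst a) (Pi (Var 0) (Var 1)))"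
    using hilbert_scheme[OF sch \<rho>(1)] \<rho> assms by (simp add: derivable_Nil)
  show "saturated [] 2 (Pi (Cst a) (Pi (Var 0) (Var 1)))"
    using scheme_saturated[OF sch _ _ \<rho>(1), of 2 4] \<rho> assms by (simp add: numeral_2_eq_2)
qed

lemma K1_derivable:
  assumes "a \<in> Sorts X" "b \<in> Sorts X"
  shows "derivable [] (lams [Cst a, Cst b, Var 1, Var 1] (Var 1))
      (pis [Cst a, Cst b, Var 1, Var 1] (Var 3))"
    and "saturated [] 4 (pis [Cst a, Cst b, Var 1, Var 1] (Var 3))"
proof -
  obtain \<rho> :: "nat \<Rightarrow> 'c" where \<rho>: "range \<rho> \<subseteq> Sorts X" "\<rho> (Suc 0) = a" "\<rho> 2 = b"
    using sort_valuation assms by metis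
  note sch = hilbert_schemes.K1[of X]
  show "derivable [] (lams [Cst a, Cst b, Var 1, Var 1] (Var 1))
      (pis [Cst a, Cst b, Var 1, Var 1] (Var 3))"
    using hilbert_scheme[OF sch \<rho>(1)] \<rho> assms by (simp add: derivable_Nil)
  have "has_pis 4 (pis [Cst 1, Cst 2, Var 1, Var 1] (Var 3) :: nat trm)"
    by (simp add: eval_nat_numeral)
  from scheme_saturated[OF sch this _ \<rho>(1), of 4]
  show "saturated [] 4 (pis [Cst a, Cst b, Var 1, Var 1] (Var 3))" using \<rho> assms by simp
qed

lemma S1_derivable:
  assumes "a \<in> Sorts X" "b \<in> Sorts X" "c \<in> Sorts X"
  shows "derivable [] (lams (S1_inst a b c) (App (App (Var 2) (Var 0)) (App (Var 1) (Var 0))))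
      (pis (S1_inst a b c) (App (App (Var 3) (Var 0)) (App (Var 1) (Var 0))))"
    and "saturated [] 6 (pis (S1_inst a b c) (App (App (Var 3) (Var 0)) (App (Var 1) (Var 0))))"
proof -
  obtain \<rho> :: "nat \<Rightarrow> 'c" where \<rho>: "range \<rho> \<subseteq> Sorts X" "\<rho> (Suc 0) = a" "\<rho> 2 = b" "\<rho> 3 = c"
    using sort_valuation assms by metis
  note sch = hilbert_schemes.S1[of X]
  show "derivable [] (lams (S1_inst a b c) (App (App (Var 2) (Var 0)) (App (Var 1) (Var 0))))
      (pis (S1_inst a b c) (App (App (Var 3) (Var 0)) (App (Var 1) (Var 0))))"
    using hilbert_scheme[OF sch \<rho>(1)] \<rho>
    by (simp add: derivable_Nil map_lams map_pis map_S1_args)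
  have "has_pis 6 (pis S1_args (App (App (Var 3) (Var 0)) (App (Var 1) (Var 0))))"
    by (simp add: S1_args_def eval_nat_numeral)
  from scheme_saturated[OF sch this _ \<rho>(1), of 4]
  have "saturated [] 6 (map_trm \<rho> (pis S1_args (App (App (Var 3) (Var 0)) (App (Var 1) (Var 0)))))"
    by (simp add: S1_args_def)
  then show "saturated [] 6 (pis (S1_inst a b c) (App (App (Var 3) (Var 0)) (App (Var 1) (Var 0))))"
    using \<rho> by (simp add: map_pis map_S1_args)
qed

text \<open>\<Pi>1 takes an argument of type \<open>Pi A (Cst b)\<close>, which needs a sort
  beforehand. The source is I1: putting \<open>Cst b\<close> for the last body in the type of I1
  gives \<open>Pi (Cst a) (Pi (Var 0) (Cst b))\<close>, whose prefix of length one is the function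
  wanted.\<close>

lemma Pi_Cst_combinator:
  assumes "a \<in> Sorts X" "b \<in> Sorts X"
  shows "\<exists>d\<in>Sorts X. derivable [] (Lam (Cst a) (Pi (Var 0) (Cst b))) (Pi (Cst a) (Cst d)) \<and>
    saturated [] (Suc 0) (Pi (Cst a) (Cst d))"
proof -
  note sat = I1_derivable(2)[OF assms(1)]
  have "tails [] 2 (pi_prefix 2 (Pi (Cst a) (Pi (Var 0) (Var 1))) b)"
    using sat assms(2) by (simp add: saturated_def)
  from tailsD[OF this, of 1] saturated_pi_prefix[OF sat, of 1] show ?thesis
    by (auto simp: eval_nat_numeral)
qed

lemma app_closed_Nil: "app_closed []"
  by (auto simp: app_closed_def derivable_Nil intro: hpts_theorem.application)

lemma contains_theorems_Nil: "contains_theorems []"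
  by (simp add: contains_theorems_def)

lemma has_sort_Nil_Cst: "has_sort [] (Cst c)"
  using ex_axiom[of c] by (auto simp: has_sort_def derivable_Nil intro: hilbert_axiom)

lemma derivable_Nil_closed: "derivable [] M A \<Longrightarrow> lift M 0 = M"
  using hilbert_sound typing_closed by (force simp: derivable_Nil)

lemma has_sort_Nil_closed: "has_sort [] A \<Longrightarrow> lift A 0 = A"
  using derivable_Nil_closed by (auto simp: has_sort_def)

end

section \<open>Rules of the PTS in a context closed under application\<close>

locale hilbert_context = supersorted_pts X for X :: "'c pts" +
  fixes \<Gamma> :: "'c trm list"
  assumes app: "app_closed \<Gamma>" and theorems: "contains_theorems \<Gamma>"
begin

lemma theoremI: "derivable [] M A \<Longrightarrow> has_sort [] A \<Longrightarrow> derivable \<Gamma> M A"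
  using theorems by (auto simp: contains_theorems_def)

lemma saturated_theoremI: "derivable [] M T \<Longrightarrow> saturated [] n T \<Longrightarrow> derivable \<Gamma> M T \<and> saturated \<Gamma> n T"
  using saturated_contains[OF theorems] tailsD[of "[]" n T 0] theoremI
  by (force simp: saturated_def has_sort_def)

lemma has_sort_theorem: "has_sort [] A \<Longrightarrow> has_sort \<Gamma> A"
  using theoremI has_sort_Nil_Cst unfolding has_sort_def[of _ A] by blast

lemma has_sort_Cst: "has_sort \<Gamma> (Cst c)"
  using has_sort_theorem has_sort_Nil_Cst by blast

text \<open>Application and contraction in one step; saturation of the new type is carried along so
  that the next argument can be supplied.\<close>

lemma saturated_step:
  assumes "derivable \<Gamma> (Lam A' L) (Pi A B) \<and> saturated \<Gamma> (Suc n) (Pi A B)"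
    and "derivable \<Gamma> N A" "has_sort \<Gamma> A"
  shows "derivable \<Gamma> (subst L N 0) (subst B N 0) \<and> saturated \<Gamma> n (subst B N 0)"
  using assms derivable_app[OF app] saturated_app[OF app] saturated_sort by blast

lemma weakening:
  assumes M: "derivable \<Gamma> M B" and B: "has_sort \<Gamma> B" and C: "has_sort \<Gamma> C"
  shows "derivable (C # \<Gamma>) (lift M 0) (lift B 0)"
proof -
  from B C obtain b c where b: "b \<in> Sorts X" "derivable \<Gamma> B (Cst b)"
    and c: "c \<in> Sorts X" "derivable \<Gamma> C (Cst c)" by (auto simp: has_sort_def)
  \<comment> \<open>K1 applied to \<open>B\<close>, \<open>C\<close> and \<open>M\<close> contracts
    to \<open>Lam C (lift M 0)\<close>.\<close>
  let ?T = "Pi (Cst b) (Pi (Cst c) (Pi (Var 1) (Pi (Var 1) (Var 3))))"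
  have "derivable \<Gamma> (Lam (Cst b) (Lam (Cst c) (Lam (Var 1) (Lam (Var 1) (Var 1))))) ?T
      \<and> saturated \<Gamma> (Suc (Suc (Suc (Suc 0)))) ?T"
    using K1_derivable[OF b(1) c(1)] by (intro saturated_theoremI) (auto simp: eval_nat_numeral)
  from saturated_step[OF this b(2) has_sort_Cst]
  have "derivable \<Gamma> (Lam (Cst c) (Lam (lift B 0) (Lam (Var 1) (Var 1))))
      (Pi (Cst c) (Pi (lift B 0) (Pi (Var 1) (lift (lift (lift B 0) 0) 0))))
    \<and> saturated \<Gamma> (Suc (Suc (Suc 0))) (Pi (Cst c) (Pi (lift B 0)
        (Pi (Var 1) (lift (lift (lift B 0) 0) 0))))"
    by (simp add: eval_nat_numeral)
  from saturated_step[OF this c(2) has_sort_Cst]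
  have "derivable \<Gamma> (Lam B (Lam (lift C 0) (Var 1))) (Pi B (Pi (lift C 0) (lift (lift B 0) 0)))
    \<and> saturated \<Gamma> (Suc (Suc 0)) (Pi B (Pi (lift C 0) (lift (lift B 0) 0)))"
    by simp
  from saturated_step[OF this M B] show ?thesis by (simp add: derivable_Cons)
qed

lemma has_sort_weakening: "has_sort \<Gamma> B \<Longrightarrow> has_sort \<Gamma> C \<Longrightarrow> has_sort (C # \<Gamma>) (lift B 0)"
  using weakening[of B "Cst s" C for s] has_sort_Cst by (auto simp: has_sort_def)

lemma start:
  assumes "has_sort \<Gamma> A"
  shows "derivable (A # \<Gamma>) (Var 0) (lift A 0)"
proof -
  from assms obtain a where a: "a \<in> Sorts X" "derivable \<Gamma> A (Cst a)" by (auto simp: has_sort_def)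
  have "derivable \<Gamma> (Lam (Cst a) (Lam (Var 0) (Var 0))) (Pi (Cst a) (Pi (Var 0) (Var 1)))
      \<and> saturated \<Gamma> (Suc (Suc 0)) (Pi (Cst a) (Pi (Var 0) (Var 1)))"
    using I1_derivable[OF a(1)] by (intro saturated_theoremI) (auto simp: eval_nat_numeral)
  from saturated_step[OF this a(2) has_sort_Cst] show ?thesis by (simp add: derivable_Cons)
qed

lemma product:
  assumes A: "derivable \<Gamma> A (Cst a)" and B: "derivable (A # \<Gamma>) B (Cst b)"
      and R: "(a, b, e) \<in> Rules X"
  shows "derivable \<Gamma> (Pi A B) (Cst e)"
proof -
  note s = rule_sorts[OF R]
  obtain d where d: "d \<in> Sorts X" "derivable [] (Lam (Cst a) (Pi (Var 0) (Cst b)))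
      (Pi (Cst a) (Cst d))"
    "saturated [] (Suc 0) (Pi (Cst a) (Cst d))"
    using Pi_Cst_combinator s by blast
  from saturated_step[OF saturated_theoremI[OF d(2,3)] A has_sort_Cst] d(1)
  have Ab: "has_sort \<Gamma> (Pi A (Cst b))" by (auto intro: has_sortI)
  let ?T = "Pi (Cst a) (Pi (Pi (Var 0) (Cst b)) (Cst e))"
  have "derivable \<Gamma> (Lam (Cst a) (Lam (Pi (Var 0) (Cst b)) (Pi (Var 1) (App (Var 1) (Var 0))))) ?T
      \<and> saturated \<Gamma> (Suc (Suc 0)) ?T"
    using Pi1_derivable[OF R] by (intro saturated_theoremI) (auto simp: eval_nat_numeral)
  from saturated_step[OF this A has_sort_Cst]
  have *: "derivable \<Gamma> (Lam (Pi A (Cst b)) (Pi (lift A 0) (App (Var 1) (Var 0))))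
      (Pi (Pi A (Cst b)) (Cst e))
      \<and> saturated \<Gamma> (Suc 0) (Pi (Pi A (Cst b)) (Cst e))"
    by simp
  have "derivable \<Gamma> (Lam A B) (Pi A (Cst b))" using B by (simp add: derivable_Cons)
  from saturated_step[OF * this Ab]
  have "derivable \<Gamma> (Pi A (App (lift (Lam A B) 0) (Var 0))) (Cst e)" by simp
  \<comment> \<open>\<Pi>1 leaves \<open>Lam A B\<close> applied to the new variable as the body;
    contraction turns it into \<open>B\<close>.\<close>
  moreover have "beta (App (lift (Lam A B) 0) (Var 0)) B"
    using beta.beta[of "lift A 0" "lift B (Suc 0)" "Var 0"] by simp
  ultimately show ?thesis by (blast intro: derivable_beta beta.PiR)
qed

lemma has_sort_Pi: "has_sort \<Gamma> A \<Longrightarrow> has_sort (A # \<Gamma>) B \<Longrightarrow> has_sort \<Gamma> (Pi A B)"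
  using product ex_rule unfolding has_sort_def by blast

text \<open>Once earlier arguments are substituted, the domain of the next one contains redexes.
  They are removed by (type reduction), which, unlike (conversion), asks for no sort of the new
  type.\<close>

lemma saturated_step_betas:
  assumes "derivable \<Gamma> (Lam A' L) (Pi A\<^sub>0 B) \<and> saturated \<Gamma> (Suc n) (Pi A\<^sub>0 B)" "beta\<^sup>*\<^sup>* A\<^sub>0 A"
    and "derivable \<Gamma> N A" "has_sort \<Gamma> A"
  shows "derivable \<Gamma> (subst L N 0) (subst B N 0) \<and> saturated \<Gamma> n (subst B N 0)"
proof -
  have "beta\<^sup>*\<^sup>* (Pi A\<^sub>0 B) (Pi A B)" using assms(2) by (intro beta_rtranclp_cong) auto
  then have "derivable \<Gamma> (Lam A' L) (Pi A B) \<and> saturated \<Gamma> (Suc n) (Pi A B)"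
    using assms(1) derivable_betas saturated_betas by blast
  from saturated_step[OF this assms(3,4)] show ?thesis .
qed

text \<open>The arguments \<open>u, v, t, w, z\<close> of S1 are \<open>C\<close> and the
  abstractions over \<open>C\<close> of \<open>A\<close>, \<open>Lam A B\<close>, \<open>M\<close>
  and \<open>N\<close>, all taken in \<Gamma>, where application is available. \<open>Ab\<close> and
  \<open>AB\<close> give sorts to the domains of \<open>t\<close> and \<open>w\<close>; they are
  premises because forming these products already requires application in
  \<open>C # \<Gamma>\<close>.\<close>

lemma S1_application:
  assumes C: "has_sort \<Gamma> C"
    and M: "derivable (C # \<Gamma>) M (Pi A B)" and N: "derivable (C # \<Gamma>) N A"
    and A: "derivable (C # \<Gamma>) A (Cst a)" "a \<in> Sorts X"
    and B: "derivable (A # C # \<Gamma>) B (Cst b)" "b \<in> Sorts X"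
    and Ab: "has_sort (C # \<Gamma>) (Pi A (Cst b))" and AB: "has_sort (C # \<Gamma>) (Pi A B)"
  shows "derivable (C # \<Gamma>) (App M N) (subst B N 0)"
proof -
  obtain c where c: "c \<in> Sorts X" "derivable \<Gamma> C (Cst c)" using C by (auto simp: has_sort_def)
  define v where "v = Lam C A"
  define t where "t = Lam C (Lam A B)"
  define w where "w = Lam C M"
  define z where "z = Lam C N"
  have v: "derivable \<Gamma> v (Pi C (Cst a))" and t: "derivable \<Gamma> t (Pi C (Pi A (Cst b)))"
    and w: "derivable \<Gamma> w (Pi C (Pi A B))" and z: "derivable \<Gamma> z (Pi C A)"
    using A B M N by (auto simp: derivable_Cons v_def t_def w_def z_def)
  have eta: "beta (App (lift (Lam C P) 0) (Var 0)) P" for P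
    using beta.beta[of "lift C 0" "lift P (Suc 0)" "Var 0"] by simp
  have vA: "beta\<^sup>*\<^sup>* (App (lift v 0) (Var 0)) A" unfolding v_def using eta by blast
  have tx: "beta (App (lift t 0) (Var 0)) (Lam A B)" unfolding t_def by (rule eta)
  have "beta (App (lift (lift t 0) 0) (Var 1)) (lift (Lam A B) 0)"
    using beta_lift[OF tx, of 0] by simp
  then have "beta (App (App (lift (lift t 0) 0) (Var 1)) (Var 0)) (App (lift (Lam A B) 0) (Var 0))"
    by (rule beta.AppL)
  moreover have "beta (App (lift (Lam A B) 0) (Var 0)) B"
    using beta.beta[of "lift A 0" "lift B (Suc 0)" "Var 0"] by simp
  ultimately have tB: "beta\<^sup>*\<^sup>* (App (App (lift (lift t 0) 0) (Var 1)) (Var 0)) B"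
    by (metis converse_rtranclp_into_rtranclp r_into_rtranclp)
  have Aa: "has_sort (C # \<Gamma>) (Cst a)" "has_sort (C # \<Gamma>) A"
    using has_sort_weakening[OF has_sort_Cst C, of a] A by (auto intro: has_sortI)
  have "derivable \<Gamma> (lams (S1_inst c a b) (App (App (Var 2) (Var 0)) (App (Var 1) (Var 0))))
      (pis (S1_inst c a b) (App (App (Var 3) (Var 0)) (App (Var 1) (Var 0)))) \<and>
    saturated \<Gamma> (Suc (Suc (Suc (Suc (Suc (Suc 0))))))
      (pis (S1_inst c a b) (App (App (Var 3) (Var 0)) (App (Var 1) (Var 0))))"
    using S1_derivable[OF c(1) A(2) B(2)]
    by (intro saturated_theoremI) (auto simp: eval_nat_numeral)
  note S = this[unfolded S1_inst_def, simplified eval_nat_numeral foldr.simps comp_apply id_apply]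
  note Su = saturated_step[OF S c(2) has_sort_Cst, simplified]
  note Sv = saturated_step[OF Su v has_sort_Pi[OF C Aa(1)], simplified]
  have "beta\<^sup>*\<^sup>* (Pi C (Pi (App (lift v 0) (Var 0)) (Cst b))) (Pi C (Pi A (Cst b)))"
    using vA by (intro beta_rtranclp_cong) auto
  note St = saturated_step_betas[OF Sv this t has_sort_Pi[OF C Ab], simplified]
  have "beta\<^sup>*\<^sup>* (Pi C
      (Pi (App (lift v 0) (Var 0)) (App (App (lift (lift t 0) 0) (Var (Suc 0))) (Var 0))))
      (Pi C (Pi A B))"
    using vA tB by (intro beta_rtranclp_cong) auto
  note Sw = saturated_step_betas[OF St this w has_sort_Pi[OF C AB], simplified]
  have "beta\<^sup>*\<^sup>* (Pi C (App (lift v 0) (Var 0))) (Pi C A)"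
    using vA by (intro beta_rtranclp_cong) auto
  note Sz = saturated_step_betas[OF Sw this z has_sort_Pi[OF C Aa(2)], simplified]
  \<comment> \<open>Five arguments have been supplied. The remaining abstraction over
    \<open>x\<close> is the declaration \<open>C\<close>, and what is left is to contract
    \<open>w x\<close> to \<open>M\<close>, \<open>z x\<close> to \<open>N\<close> and
    \<open>t x (z x)\<close> to \<open>subst B N 0\<close>.\<close>
  have zN: "beta (App (lift z 0) (Var 0)) N" unfolding z_def by (rule eta)
  have "beta (App (lift w 0) (Var 0)) M" unfolding w_def by (rule eta)
  with zN have "beta\<^sup>*\<^sup>* (Lam C (App (App (lift w 0) (Var 0)) (App (lift z 0) (Var 0))))
      (Lam C (App M N))"
    by (intro beta_rtranclp_cong) auto
  moreover have "beta\<^sup>*\<^sup>* (App (App (lift t 0) (Var 0)) (App (lift z 0) (Var 0))) (App (Lam A B) N)"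
    using tx zN by (intro beta_rtranclp_cong) auto
  then have "beta\<^sup>*\<^sup>* (App (App (lift t 0) (Var 0)) (App (lift z 0) (Var 0))) (subst B N 0)"
    using beta.beta by (rule rtranclp.rtrancl_into_rtrancl)
  then have "beta\<^sup>*\<^sup>* (Pi C (App (App (lift t 0) (Var 0)) (App (lift z 0) (Var 0))))
      (Pi C (subst B N 0))"
    by (intro beta_rtranclp_cong) auto
  ultimately show ?thesis using Sz by (auto simp: derivable_Cons intro: derivable_betas)
qed

lemma contains_theorems_Cons:
  assumes C: "has_sort \<Gamma> C"
  shows "contains_theorems (C # \<Gamma>)"
  unfolding contains_theorems_def
proof (intro allI impI)
  fix M A assume *: "derivable [] M A" "has_sort [] A"
  from weakening[OF theoremI[OF *] has_sort_theorem[OF *(2)] C] show "derivable (C # \<Gamma>) M A"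
    using * by (simp add: derivable_Nil_closed has_sort_Nil_closed)
qed

end

section \<open>Passing to a longer context\<close>

context supersorted_pts
begin

lemma hilbert_context_Nil: "hilbert_context X []"
  by unfold_locales (simp_all add: app_closed_Nil contains_theorems_Nil)

lemmas product_theorem = hilbert_context.has_sort_Pi[OF hilbert_context_Nil]

end

context hilbert_context
begin

text \<open>For a function whose type is closed, the product premises of
  \<open>S1_application\<close> can be met: both products are formed in the empty context by
  \<open>product_theorem\<close> and then weakened.\<close>

lemma theorem_application:
  assumes C: "has_sort \<Gamma> C" and F: "derivable [] (Lam A' L) (Pi A B)"
    and A: "has_sort [] A" and B: "has_sort [A] B" and N: "derivable (C # \<Gamma>) N A"
  shows "derivable (C # \<Gamma>) (subst L N 0) (subst B N 0)"
proof -
  note thms = contains_theorems_Cons[OF C, unfolded contains_theorems_def, rule_format]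
  obtain a where a: "a \<in> Sorts X" "derivable [] A (Cst a)" using A by (auto simp: has_sort_def)
  obtain b where b: "b \<in> Sorts X" "derivable [] (Lam A B) (Pi A (Cst b))"
    using B by (auto simp: has_sort_Cons)
  have Cstb: "has_sort [A] (Cst b)"
    using hilbert_context.has_sort_weakening[OF hilbert_context_Nil has_sort_Nil_Cst A, of b]
      by simp
  have lift: "has_sort (C # \<Gamma>) P" if "has_sort [] P" for P
    using that thms has_sort_Nil_Cst unfolding has_sort_def by blast
  have "derivable (C # \<Gamma>) (App (Lam A' L) N) (subst B N 0)"
  proof (rule S1_application[OF C _ N])
    show "derivable (C # \<Gamma>) (Lam A' L) (Pi A B)" using F A B by (intro thms product_theorem)
    show "derivable (C # \<Gamma>) A (Cst a)" using a has_sort_Nil_Cst by (intro thms)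
    show "derivable (A # C # \<Gamma>) B (Cst b)"
      unfolding derivable_Cons[of A] using b(2) A Cstb by (intro thms product_theorem)
    show "has_sort (C # \<Gamma>) (Pi A (Cst b))" using A Cstb by (intro lift product_theorem)
    show "has_sort (C # \<Gamma>) (Pi A B)" using A B by (intro lift product_theorem)
  qed (use a b in auto)
  then show ?thesis by (rule derivable_beta) (rule beta.beta)
qed

text \<open>These are the two product premises of \<open>S1_application\<close>. Combinators are
  applied to \<open>A : Cst a\<close> by \<open>theorem_application\<close>; the one further
  application, to \<open>Lam A B\<close>, has the constant codomain \<open>Cst e\<close>, and its
  own product premises come from closed functions applied to \<open>A\<close>.\<close>

lemma has_sort_Pi_Cons:
  assumes C: "has_sort \<Gamma> C" and A: "derivable (C # \<Gamma>) A (Cst a)" "a \<in> Sorts X"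
    and B: "derivable (A # C # \<Gamma>) B (Cst b)" "b \<in> Sorts X"
  shows "has_sort (C # \<Gamma>) (Pi A (Cst b))" and "has_sort (C # \<Gamma>) (Pi A B)"
proof -
  note app = theorem_application[OF C _ has_sort_Nil_Cst _ A(1)]
  obtain d where d: "d \<in> Sorts X" "derivable [] (Lam (Cst a) (Pi (Var 0) (Cst b)))
      (Pi (Cst a) (Cst d))"
    "saturated [] (Suc 0) (Pi (Cst a) (Cst d))"
    using Pi_Cst_combinator[OF A(2) B(2)] by blast
  from app[OF d(2) saturated_sort[OF d(3)]] have Ab: "derivable (C # \<Gamma>) (Pi A (Cst b)) (Cst d)"
    by simp
  then show "has_sort (C # \<Gamma>) (Pi A (Cst b))" using d(1) by (rule has_sortI)
  obtain e where e: "e \<in> Sorts X" "(a, b, e) \<in> Rules X" using ex_rule[OF A(2) B(2)] by blast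
  let ?T = "\<lambda>e. Pi (Cst a) (Pi (Pi (Var 0) (Cst b)) (Cst e))"
  have sat: "saturated [] (Suc (Suc 0)) (?T e)"
    using Pi1_derivable(2)[OF e(2)] by (simp add: eval_nat_numeral)
  \<comment> \<open>The prefix of length one of \<open>?T e'\<close> is a closed function; its value
    at \<open>A\<close> is the product to be sorted. It is used for \<open>e\<close> and for the
    sort of \<open>e\<close> found below.\<close>
  have pi_sort: "has_sort (C # \<Gamma>) (Pi (Pi A (Cst b)) (Cst e'))"
      if "saturated [] (Suc (Suc 0)) (?T e')" for e'
  proof -
    from that tailsD[of "[]" "Suc (Suc 0)" "?T e'" 1] obtain s where s: "s \<in> Sorts X"
      "derivable [] (Lam (Cst a) (Pi (Pi (Var 0) (Cst b)) (Cst e'))) (Pi (Cst a) (Cst s))"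
      by (auto simp: saturated_def)
    have "has_sort [Cst a] (Cst s)"
      using hilbert_context.has_sort_weakening[OF hilbert_context_Nil has_sort_Nil_Cst has_sort_Nil_Cst, of a s]
        by simp
    from app[OF s(2) this] show ?thesis using s(1) by (auto intro: has_sortI)
  qed
  \<comment> \<open>A typing of \<open>Cst e\<close> under the declaration
    \<open>Pi A (Cst b)\<close> is needed, but weakening in \<open>C # \<Gamma>\<close> is not yet
    available. The prefix of length two of \<open>?T e\<close>, applied to \<open>A\<close>,
    contains it.\<close>
  from sat tailsD[of "[]" "Suc (Suc 0)" "?T e" "Suc (Suc 0)"] obtain e' where e': "e' \<in> Sorts X"
    "derivable [] (Lam (Cst a) (Lam (Pi (Var 0) (Cst b)) (Cst e))) (?T e')"
    by (auto simp: saturated_def)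
  have sat': "saturated [] (Suc (Suc 0)) (?T e')"
    using saturated_pi_prefix[OF sat, of "Suc (Suc 0)"] e' by simp
  \<comment> \<open>\<Pi>1 at \<open>A\<close>, applied to \<open>Lam A B\<close>: the domain is
    \<open>Pi A (Cst b)\<close> of sort \<open>d\<close>, and the codomain is \<open>Cst e\<close>
    of sort \<open>e'\<close>.\<close>
  have "derivable (C # \<Gamma>) (App (Lam (Pi A (Cst b)) (Pi (lift A 0) (App (Var 1) (Var 0)))) (Lam A B))
      (subst (Cst e) (Lam A B) 0)"
  proof (rule S1_application[OF C])
    show "derivable (C # \<Gamma>) (Lam (Pi A (Cst b)) (Pi (lift A 0) (App (Var 1) (Var 0))))
        (Pi (Pi A (Cst b)) (Cst e))"
      using app[OF Pi1_derivable(1)[OF e(2)] saturated_sort[OF sat]] by simp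
    show "derivable (C # \<Gamma>) (Lam A B) (Pi A (Cst b))" using B(1) by (simp only: derivable_Cons)
    show "derivable (Pi A (Cst b) # C # \<Gamma>) (Cst e) (Cst e')"
      unfolding derivable_Cons[of "Pi A (Cst b)"]
        using app[OF e'(2) saturated_sort[OF sat']] by simp
  qed (use Ab d e e' pi_sort sat sat' in auto)
  then have "derivable (C # \<Gamma>) (Pi A (App (lift (Lam A B) 0) (Var 0))) (Cst e)"
    using derivable_beta[OF _ beta.beta] by fastforce
  moreover have "beta (App (lift (Lam A B) 0) (Var 0)) B"
    using beta.beta[of "lift A 0" "lift B (Suc 0)" "Var 0"] by simp
  ultimately show "has_sort (C # \<Gamma>) (Pi A B)"
    using e(1) by (blast intro: derivable_beta beta.PiR has_sortI)
qed

text \<open>The step of the induction on contexts: \<open>has_sort_Pi_Cons\<close> discharges the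
  product premises of \<open>S1_application\<close>, and what remains is
  \<open>app_closed\<close>.\<close>

lemma hilbert_context_Cons:
  assumes C: "has_sort \<Gamma> C"
  shows "hilbert_context X (C # \<Gamma>)"
proof unfold_locales
  show "app_closed (C # \<Gamma>)"
    unfolding app_closed_def
  proof (intro allI impI)
    fix M N A B
    assume M: "derivable (C # \<Gamma>) M (Pi A B)" and N: "derivable (C # \<Gamma>) N A"
      and "has_sort (C # \<Gamma>) A" "has_sort (A # C # \<Gamma>) B"
    then obtain a b where A: "derivable (C # \<Gamma>) A (Cst a)" "a \<in> Sorts X"
      and B: "derivable (A # C # \<Gamma>) B (Cst b)" "b \<in> Sorts X"
      by (auto simp: has_sort_def)
    from S1_application[OF C M N A B has_sort_Pi_Cons[OF C A B]]
    show "derivable (C # \<Gamma>) (App M N) (subst B N 0)" .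
  qed
  show "contains_theorems (C # \<Gamma>)" using C by (rule contains_theorems_Cons)
qed

lemma derivable_conv:
  assumes "derivable \<Gamma> M A" "hilbert (pis (rev \<Gamma>) B) (Cst s)" "s \<in> Sorts X" "beta_conv A B"
  shows "derivable \<Gamma> M B"
  unfolding derivable_def
proof (rule hpts_theorem.conversion)
  show "beta_conv (pis (rev \<Gamma>) A) (pis (rev \<Gamma>) B)"
    using assms(4) by (rule beta_conv_map) (rule beta_pis)
qed (use assms in \<open>auto simp: derivable_def corresponding_hpts_def\<close>)

end

section \<open>Completeness\<close>

context supersorted_pts
begin

primrec hilbert_wf :: "'c trm list \<Rightarrow> bool" where
  "hilbert_wf [] \<longleftrightarrow> True"
| "hilbert_wf (A # \<Gamma>) \<longleftrightarrow> hilbert_wf \<Gamma> \<and> has_sort \<Gamma> A"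

lemma hilbert_wf_context: "hilbert_wf \<Gamma> \<Longrightarrow> hilbert_context X \<Gamma>"
  by (induction \<Gamma>) (auto intro: hilbert_context_Nil hilbert_context.hilbert_context_Cons)

text \<open>(conversion) in the Hilbert-style system acts on the whole type
  \<open>pis (rev \<Gamma>) B\<close>, which therefore needs a sort; each declaration is absorbed by
  one product.\<close>

lemma has_sort_pis: "hilbert_wf \<Gamma> \<Longrightarrow> has_sort \<Gamma> B \<Longrightarrow> has_sort [] (pis (rev \<Gamma>) B)"
proof (induction \<Gamma> arbitrary: B)
  case (Cons C \<Gamma>)
  then show ?case using hilbert_context.has_sort_Pi[OF hilbert_wf_context] by auto
qed simp

theorem typing_derivable: "typing \<Gamma> M A \<Longrightarrow> hilbert_wf \<Gamma> \<and> derivable \<Gamma> M A"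
proof (induction rule: typing.induct)
  case (ax c s)
  then show ?case by (auto simp: derivable_Nil intro: hilbert_axiom)
next
  case (start \<Gamma> A s)
  then have "hilbert_wf \<Gamma>" "has_sort \<Gamma> A" by (auto intro: has_sortI)
  then show ?case by (auto intro: hilbert_context.start hilbert_wf_context)
next
  case (weak \<Gamma> M B b A a)
  then have "hilbert_wf \<Gamma>" "has_sort \<Gamma> A" "has_sort \<Gamma> B" "derivable \<Gamma> M B"
    by (auto intro: has_sortI)
  then show ?case by (auto intro: hilbert_context.weakening hilbert_wf_context)
next
  case (app \<Gamma> M A B N a b)
  then have "hilbert_wf \<Gamma>" "has_sort \<Gamma> A" "has_sort (A # \<Gamma>) B" by (auto intro: has_sortI)
  then show ?case using app hilbert_context.app[OF hilbert_wf_context]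
    by (auto simp: app_closed_def)
next
  case (lam A \<Gamma> M B a b)
  then show ?case by (auto simp: derivable_Cons)
next
  case (prod \<Gamma> A s1 B s2 s3)
  then show ?case by (auto intro: hilbert_context.product hilbert_wf_context)
next
  case (conv \<Gamma> M A B s)
  then have "has_sort [] (pis (rev \<Gamma>) B)" by (auto intro: has_sort_pis has_sortI)
  then obtain s' where "s' \<in> Sorts X" "hilbert (pis (rev \<Gamma>) B) (Cst s')"
    by (auto simp: has_sort_def derivable_Nil)
  then show ?case using conv hilbert_context.derivable_conv[OF hilbert_wf_context] by blast
qed

end

theorem theorem28:
  fixes X :: "'c pts"
  assumes "is_pts X"
    and "supersorted X"
  shows "\<forall>M A. pts_theorem X M A \<longleftrightarrow> hpts_theorem (corresponding_hpts X) M A"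
proof -
  interpret supersorted_pts X using assms by unfold_locales
  show ?thesis
    using typing_derivable[of "[]"] hilbert_sound
    by (auto simp: derivable_Nil simp flip: typing_iff_pts_typing)
qed

end
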